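(* Let $\mathcal{T}',\mathcal{T},\mathcal{T}''$ be triangulated categories which form a recollement with triangle functors $i\colon\mathcal{T}'\to\mathcal{T}$, $i_\lambda,i_\rho\colon\mathcal{T}\to\mathcal{T}'$, $j\colon\mathcal{T}\to\mathcal{T}''$, $j_\lambda,j_\rho\colon\mathcal{T}''\to\mathcal{T}$, and let $\phi\colon j_\lambda j\to\mathrm{Id}_{\mathcal{T}}$ be the counit of $(j_\lambda,j)$. Then the functor $$\Phi\colon\mathcal{T}\longrightarrow(i_\rho j_\lambda\downarrow\mathcal{T}'),\quad X\mapsto(j(X),i_\rho(X);i_\rho(\phi_X)),\quad f\mapsto(j(f),i_\rho(f))$$ is full and dense, and its kernel ideal is square zero. In particular, $\Phi$ is an epivalence.
   Context: A recollement consists of triangulated categories $\mathcal{T}',\mathcal{T},\mathcal{T}''$ and triangle functors $i\colon\mathcal{T}'\to\mathcal{T}$, $i_\lambda,i_\rho\colon\mathcal{T}\to\mathcal{T}'$, $j\colon\mathcal{T}\to\mathcal{T}''$, $j_\lambda,j_\rho\colon\mathcal{T}''\to\mathcal{T}$ such that: (1) $(i_\lambda,i)$, $(i,i_\rho)$, $(j_\lambda,j)$, $(j,j_\rho)$ are adjoint pairs (left adjoint written first); (2) $i,j_\lambda,j_\rho$ are fully faithful; (3) $ji\simeq 0$; (4) for each $X\in\mathcal{T}$ there are exact triangles $ii_\rho(X)\xrightarrow{\varepsilon_X}X\xrightarrow{\eta_X}j_\rho j(X)\xrightarrow{\delta_X}\Sigma ii_\rho(X)$ and $j_\lambda j(X)\xrightarrow{\phi_X}X\xrightarrow{\psi_X}ii_\lambda(X)\xrightarrow{\sigma_X}\Sigma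 j_\lambda j(X)$, where $\varepsilon,\phi$ are the counits of $(i,i_\rho)$, $(j_\lambda,j)$ and $\eta,\psi$ are the units of $(j,j_\rho)$, $(i_\lambda,i)$. For a functor $F\colon\mathcal{C}\to\mathcal{D}$, the comma category $(F\downarrow\mathcal{D})$ has as objects the triples $(C,D;f)$ with $C\in\mathcal{C}$, $D\in\mathcal{D}$ and $f\colon F(C)\to D$ a morphism in $\mathcal{D}$; morphisms $(C,D;f)\to(C',D';f')$ are pairs $(a,b)$ with $a\colon C\to C'$, $b\colon D\to D'$ and $f'\circ F(a)=b\circ f$. Here it is applied to $F=i_\rho j_\lambda\colon\mathcal{T}''\to\mathcal{T}'$. The kernel ideal of an additive functor is the class of all morphisms annihilated by it. An ideal is square zero if the composite of any two composable morphisms in it is zero. A functor is dense if it is essentially surjective on objects. A functor is an epivalence if it is full, dense, and detects isomorphisms between objects (a morphism is an isomorphism whenever its image is). *)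

theory Defs
  imports "HOL-Algebra.Group"
begin

section \<open>Categories, functors and natural transformations\<close>

text \<open>
  Every arrow carries its source and target, so distinct Hom sets are disjoint. Operations are
  total functions on the underlying types and are only meaningful on objects and (composable)
  arrows.
\<close>

record ('o, 'm) cat =
  obj :: "'o set"
  arr :: "'m set"
  src :: "'m \<Rightarrow> 'o"
  tgt :: "'m \<Rightarrow> 'o"
  ident :: "'o \<Rightarrow> 'm"
  cmp :: "'m \<Rightarrow> 'm \<Rightarrow> 'm"  (infixl \<open>\<cdot>\<index>\<close> 70)

definition Hom :: "('o, 'm, 'z) cat_scheme \<Rightarrow> 'o \<Rightarrow> 'o \<Rightarrow> 'm set" where
  "Hom C X Y = {f \<in> arr C. src C f = X \<and> tgt C f = Y}"

locale category =
  fixes C :: "('o, 'm, 'z) cat_scheme" (structure)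
  assumes src_closed: "f \<in> arr C \<Longrightarrow> src C f \<in> obj C"
    and tgt_closed: "f \<in> arr C \<Longrightarrow> tgt C f \<in> obj C"
    and ident_closed: "X \<in> obj C \<Longrightarrow> ident C X \<in> Hom C X X"
    and comp_closed: "f \<in> Hom C X Y \<Longrightarrow> g \<in> Hom C Y Z \<Longrightarrow> g \<cdot> f \<in> Hom C X Z"
    and comp_assoc: "f \<in> Hom C W X \<Longrightarrow> g \<in> Hom C X Y \<Longrightarrow> h \<in> Hom C Y Z \<Longrightarrow>
      (h \<cdot> g) \<cdot> f = h \<cdot> (g \<cdot> f)"
    and comp_ident_left: "f \<in> Hom C X Y \<Longrightarrow> ident C Y \<cdot> f = f"
    and comp_ident_right: "f \<in> Hom C X Y \<Longrightarrow> f \<cdot> ident C X = f"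

definition is_iso :: "('o, 'm, 'z) cat_scheme \<Rightarrow> 'm \<Rightarrow> bool" where
  "is_iso C f \<longleftrightarrow> f \<in> arr C \<and>
    (\<exists>g \<in> Hom C (tgt C f) (src C f).
      g \<cdot>\<^bsub>C\<^esub> f = ident C (src C f) \<and> f \<cdot>\<^bsub>C\<^esub> g = ident C (tgt C f))"

definition isomorphic :: "('o, 'm, 'z) cat_scheme \<Rightarrow> 'o \<Rightarrow> 'o \<Rightarrow> bool" where
  "isomorphic C X Y \<longleftrightarrow> (\<exists>f \<in> Hom C X Y. is_iso C f)"

definition zero_object :: "('o, 'm, 'z) cat_scheme \<Rightarrow> 'o \<Rightarrow> bool" where
  "zero_object C Z \<longleftrightarrow> Z \<in> obj C \<and>
    (\<forall>X \<in> obj C. (\<exists>!f. f \<in> Hom C X Z) \<and> (\<exists>!f. f \<in> Hom C Z X))"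

record ('o, 'm, 'p, 'n) functor_data =
  omap :: "'o \<Rightarrow> 'p"
  amap :: "'m \<Rightarrow> 'n"

locale is_functor =
  dom: category C + cod: category D
  for C :: "('o, 'm, 'y) cat_scheme" and D :: "('p, 'n, 'z) cat_scheme" +
  fixes F :: "('o, 'm, 'p, 'n, 'w) functor_data_scheme"
  assumes omap_closed: "X \<in> obj C \<Longrightarrow> omap F X \<in> obj D"
    and amap_closed: "f \<in> Hom C X Y \<Longrightarrow> amap F f \<in> Hom D (omap F X) (omap F Y)"
    and amap_ident: "X \<in> obj C \<Longrightarrow> amap F (ident C X) = ident D (omap F X)"
    and amap_comp: "f \<in> Hom C X Y \<Longrightarrow> g \<in> Hom C Y Z \<Longrightarrow>
      amap F (g \<cdot>\<^bsub>C\<^esub> f) = amap F g \<cdot>\<^bsub>D\<^esub> amap F f"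

definition id_functor :: "('o, 'm, 'o, 'm) functor_data" where
  "id_functor = \<lparr>omap = (\<lambda>X. X), amap = (\<lambda>f. f)\<rparr>"

definition comp_functor ::
    "('p, 'n, 'q, 'l, 'y) functor_data_scheme \<Rightarrow> ('o, 'm, 'p, 'n, 'z) functor_data_scheme
      \<Rightarrow> ('o, 'm, 'q, 'l) functor_data"  (infixr \<open>\<circ>\<^sub>F\<close> 75) where
  "G \<circ>\<^sub>F F = \<lparr>omap = (\<lambda>X. omap G (omap F X)), amap = (\<lambda>f. amap G (amap F f))\<rparr>"

definition full ::
    "('o, 'm, 'y) cat_scheme \<Rightarrow> ('p, 'n, 'z) cat_scheme
      \<Rightarrow> ('o, 'm, 'p, 'n, 'w) functor_data_scheme \<Rightarrow> bool" where
  "full C D F \<longleftrightarrow> (\<forall>X \<in> obj C. \<forall>Y \<in> obj C. \<forall>g \<in> Hom D (omap F X) (omap F Y).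
    \<exists>f \<in> Hom C X Y. amap F f = g)"

definition faithful ::
    "('o, 'm, 'z) cat_scheme \<Rightarrow> ('o, 'm, 'p, 'n, 'w) functor_data_scheme \<Rightarrow> bool" where
  "faithful C F \<longleftrightarrow> (\<forall>X \<in> obj C. \<forall>Y \<in> obj C. inj_on (amap F) (Hom C X Y))"

definition dense ::
    "('o, 'm, 'y) cat_scheme \<Rightarrow> ('p, 'n, 'z) cat_scheme
      \<Rightarrow> ('o, 'm, 'p, 'n, 'w) functor_data_scheme \<Rightarrow> bool" where
  "dense C D F \<longleftrightarrow> (\<forall>Y \<in> obj D. \<exists>X \<in> obj C. isomorphic D (omap F X) Y)"

definition detects_isos ::
    "('o, 'm, 'y) cat_scheme \<Rightarrow> ('p, 'n, 'z) cat_scheme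
      \<Rightarrow> ('o, 'm, 'p, 'n, 'w) functor_data_scheme \<Rightarrow> bool" where
  "detects_isos C D F \<longleftrightarrow> (\<forall>f \<in> arr C. is_iso D (amap F f) \<longrightarrow> is_iso C f)"

definition epivalence ::
    "('o, 'm, 'y) cat_scheme \<Rightarrow> ('p, 'n, 'z) cat_scheme
      \<Rightarrow> ('o, 'm, 'p, 'n, 'w) functor_data_scheme \<Rightarrow> bool" where
  "epivalence C D F \<longleftrightarrow> is_functor C D F \<and> full C D F \<and> dense C D F \<and> detects_isos C D F"

locale natural_transformation =
  S: is_functor C D F + T: is_functor C D G
  for C :: "('o, 'm, 'x) cat_scheme" and D :: "('p, 'n, 'y) cat_scheme"
    and F :: "('o, 'm, 'p, 'n, 'v) functor_data_scheme"
    and G :: "('o, 'm, 'p, 'n, 'w) functor_data_scheme" +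
  fixes \<alpha> :: "'o \<Rightarrow> 'n"
  assumes component_closed: "X \<in> obj C \<Longrightarrow> \<alpha> X \<in> Hom D (omap F X) (omap G X)"
    and naturality: "f \<in> Hom C X Y \<Longrightarrow> \<alpha> Y \<cdot>\<^bsub>D\<^esub> amap F f = amap G f \<cdot>\<^bsub>D\<^esub> \<alpha> X"

definition natural_isomorphism ::
    "('o, 'm, 'x) cat_scheme \<Rightarrow> ('p, 'n, 'y) cat_scheme
      \<Rightarrow> ('o, 'm, 'p, 'n, 'v) functor_data_scheme \<Rightarrow> ('o, 'm, 'p, 'n, 'w) functor_data_scheme
      \<Rightarrow> ('o \<Rightarrow> 'n) \<Rightarrow> bool" where
  "natural_isomorphism C D F G \<alpha> \<longleftrightarrow>
    natural_transformation C D F G \<alpha> \<and> (\<forall>X \<in> obj C. is_iso D (\<alpha> X))"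

text \<open>The functor \<open>F\<close> from \<open>C\<close> to \<open>D\<close> is left adjoint to \<open>G\<close>, with unit \<open>\<eta>\<close> and counit \<open>\<epsilon>\<close>.\<close>

locale adjoint_pair =
  left: is_functor C D F + right: is_functor D C G +
  unit: natural_transformation C C id_functor "G \<circ>\<^sub>F F" \<eta> +
  counit: natural_transformation D D "F \<circ>\<^sub>F G" id_functor \<epsilon>
  for C :: "('o, 'm, 'x) cat_scheme" and D :: "('p, 'n, 'y) cat_scheme"
    and F :: "('o, 'm, 'p, 'n, 'v) functor_data_scheme"
    and G :: "('p, 'n, 'o, 'm, 'w) functor_data_scheme"
    and \<eta> :: "'o \<Rightarrow> 'm" and \<epsilon> :: "'p \<Rightarrow> 'n" +
  assumes triangle_left: "X \<in> obj C \<Longrightarrow>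
      \<epsilon> (omap F X) \<cdot>\<^bsub>D\<^esub> amap F (\<eta> X) = ident D (omap F X)"
    and triangle_right: "Y \<in> obj D \<Longrightarrow>
      amap G (\<epsilon> Y) \<cdot>\<^bsub>C\<^esub> \<eta> (omap G Y) = ident C (omap G Y)"

definition equivalence ::
    "('o, 'm, 'y) cat_scheme \<Rightarrow> ('p, 'n, 'z) cat_scheme
      \<Rightarrow> ('o, 'm, 'p, 'n, 'w) functor_data_scheme \<Rightarrow> bool" where
  "equivalence C D F \<longleftrightarrow> (\<exists>(G :: ('p, 'n, 'o, 'm) functor_data) \<alpha> \<beta>.
    is_functor C D F \<and> is_functor D C G \<and>
    natural_isomorphism C C id_functor (G \<circ>\<^sub>F F) \<alpha> \<and>
    natural_isomorphism D D (F \<circ>\<^sub>F G) id_functor \<beta>)"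


section \<open>Additive categories\<close>

record ('o, 'm) add_cat = "('o, 'm) cat" +
  add :: "'m \<Rightarrow> 'm \<Rightarrow> 'm"  (infixl \<open>\<^bold>+\<index>\<close> 65)
  zero :: "'o \<Rightarrow> 'o \<Rightarrow> 'm"

definition hom_group :: "('o, 'm, 'z) add_cat_scheme \<Rightarrow> 'o \<Rightarrow> 'o \<Rightarrow> 'm monoid" where
  "hom_group C X Y = \<lparr>carrier = Hom C X Y, mult = add C, one = zero C X Y\<rparr>"

definition neg :: "('o, 'm, 'z) add_cat_scheme \<Rightarrow> 'm \<Rightarrow> 'm" where
  "neg C f = inv\<^bsub>hom_group C (src C f) (tgt C f)\<^esub> f"

locale preadditive_category = category C
  for C :: "('o, 'm, 'z) add_cat_scheme" (structure) +
  assumes hom_comm_group: "X \<in> obj C \<Longrightarrow> Y \<in> obj C \<Longrightarrow> comm_group (hom_group C X Y)"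
    and comp_additive_left: "f \<in> Hom C X Y \<Longrightarrow> Z \<in> obj C \<Longrightarrow>
      (\<lambda>g. g \<cdot> f) \<in> hom (hom_group C Y Z) (hom_group C X Z)"
    and comp_additive_right: "g \<in> Hom C Y Z \<Longrightarrow> X \<in> obj C \<Longrightarrow>
      (\<lambda>f. g \<cdot> f) \<in> hom (hom_group C X Y) (hom_group C X Z)"

definition is_biproduct ::
    "('o, 'm, 'z) add_cat_scheme \<Rightarrow> 'o \<Rightarrow> 'o \<Rightarrow> 'o \<Rightarrow> 'm \<Rightarrow> 'm \<Rightarrow> 'm \<Rightarrow> 'm \<Rightarrow> bool" where
  "is_biproduct C X Y B i1 i2 p1 p2 \<longleftrightarrow> B \<in> obj C \<and>
    i1 \<in> Hom C X B \<and> i2 \<in> Hom C Y B \<and> p1 \<in> Hom C B X \<and> p2 \<in> Hom C B Y \<and>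
    p1 \<cdot>\<^bsub>C\<^esub> i1 = ident C X \<and> p2 \<cdot>\<^bsub>C\<^esub> i2 = ident C Y \<and>
    p1 \<cdot>\<^bsub>C\<^esub> i2 = zero C Y X \<and> p2 \<cdot>\<^bsub>C\<^esub> i1 = zero C X Y \<and>
    (i1 \<cdot>\<^bsub>C\<^esub> p1) \<^bold>+\<^bsub>C\<^esub> (i2 \<cdot>\<^bsub>C\<^esub> p2) = ident C B"

locale additive_category = preadditive_category +
  assumes zero_object_exists: "\<exists>Z. zero_object C Z"
    and biproduct_exists: "X \<in> obj C \<Longrightarrow> Y \<in> obj C \<Longrightarrow>
      \<exists>B i1 i2 p1 p2. is_biproduct C X Y B i1 i2 p1 p2"

locale additive_functor =
  is_functor C D F + dom: preadditive_category C + cod: preadditive_category D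
  for C :: "('o, 'm, 'y) add_cat_scheme" and D :: "('p, 'n, 'z) add_cat_scheme"
    and F :: "('o, 'm, 'p, 'n, 'w) functor_data_scheme" +
  assumes amap_additive: "X \<in> obj C \<Longrightarrow> Y \<in> obj C \<Longrightarrow>
    amap F \<in> hom (hom_group C X Y) (hom_group D (omap F X) (omap F Y))"

definition kernel_ideal ::
    "('o, 'm, 'y) add_cat_scheme \<Rightarrow> ('p, 'n, 'z) add_cat_scheme
      \<Rightarrow> ('o, 'm, 'p, 'n, 'w) functor_data_scheme \<Rightarrow> 'm set" where
  "kernel_ideal C D F =
    {f \<in> arr C. amap F f = zero D (omap F (src C f)) (omap F (tgt C f))}"

definition square_zero :: "('o, 'm, 'z) add_cat_scheme \<Rightarrow> 'm set \<Rightarrow> bool" where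
  "square_zero C I \<longleftrightarrow> (\<forall>f \<in> I. \<forall>g \<in> I. tgt C f = src C g \<longrightarrow>
    g \<cdot>\<^bsub>C\<^esub> f = zero C (src C f) (tgt C g))"


section \<open>Triangulated categories\<close>

text \<open>
  A triple \<open>(f, g, h)\<close> in \<open>exact C\<close> is an exact (distinguished) triangle. The suspension is
  only required to be an autoequivalence, which includes the case of an automorphism.
\<close>

record ('o, 'm) tri_cat = "('o, 'm) add_cat" +
  susp :: "('o, 'm, 'o, 'm) functor_data"
  exact :: "('m \<times> 'm \<times> 'm) set"

definition is_triangle ::
    "('o, 'm, 'z) tri_cat_scheme \<Rightarrow> 'o \<Rightarrow> 'o \<Rightarrow> 'o \<Rightarrow> 'm \<Rightarrow> 'm \<Rightarrow> 'm \<Rightarrow> bool" where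
  "is_triangle C X Y Z f g h \<longleftrightarrow>
    f \<in> Hom C X Y \<and> g \<in> Hom C Y Z \<and> h \<in> Hom C Z (omap (susp C) X)"

definition triangle_morphism ::
    "('o, 'm, 'z) tri_cat_scheme \<Rightarrow> 'm \<Rightarrow> 'm \<Rightarrow> 'm \<Rightarrow> 'm \<Rightarrow> 'm \<Rightarrow> 'm
      \<Rightarrow> 'm \<Rightarrow> 'm \<Rightarrow> 'm \<Rightarrow> bool" where
  "triangle_morphism C f g h f' g' h' a b c \<longleftrightarrow>
    a \<in> Hom C (src C f) (src C f') \<and> b \<in> Hom C (src C g) (src C g') \<and>
    c \<in> Hom C (src C h) (src C h') \<and>
    b \<cdot>\<^bsub>C\<^esub> f = f' \<cdot>\<^bsub>C\<^esub> a \<and> c \<cdot>\<^bsub>C\<^esub> g = g' \<cdot>\<^bsub>C\<^esub> b \<and>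
    amap (susp C) a \<cdot>\<^bsub>C\<^esub> h = h' \<cdot>\<^bsub>C\<^esub> c"

locale triangulated_category = additive_category C
  for C :: "('o, 'm, 'z) tri_cat_scheme" (structure) +
  assumes susp_additive: "additive_functor C C (susp C)"
    and susp_equivalence: "equivalence C C (susp C)"
    and exact_is_triangle: "(f, g, h) \<in> exact C \<Longrightarrow> \<exists>X Y Z. is_triangle C X Y Z f g h"
    and exact_iso_closed: "(f, g, h) \<in> exact C \<Longrightarrow> is_triangle C X Y Z f' g' h' \<Longrightarrow>
      triangle_morphism C f g h f' g' h' a b c \<Longrightarrow> is_iso C a \<Longrightarrow> is_iso C b \<Longrightarrow> is_iso C c \<Longrightarrow>
      (f', g', h') \<in> exact C"
    and exact_ident: "X \<in> obj C \<Longrightarrow> zero_object C Z \<Longrightarrow>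
      (ident C X, zero C X Z, zero C Z (omap (susp C) X)) \<in> exact C"
    and exact_completion: "f \<in> arr C \<Longrightarrow> \<exists>g h. (f, g, h) \<in> exact C"
    and exact_rotate: "is_triangle C X Y Z f g h \<Longrightarrow>
      (f, g, h) \<in> exact C \<longleftrightarrow> (g, h, neg C (amap (susp C) f)) \<in> exact C"
    and exact_morphism_completion: "(f, g, h) \<in> exact C \<Longrightarrow> (f', g', h') \<in> exact C \<Longrightarrow>
      a \<in> Hom C (src C f) (src C f') \<Longrightarrow> b \<in> Hom C (src C g) (src C g') \<Longrightarrow>
      b \<cdot> f = f' \<cdot> a \<Longrightarrow> \<exists>c. triangle_morphism C f g h f' g' h' a b c"
    and octahedral: "f \<in> Hom C X Y \<Longrightarrow> g \<in> Hom C Y Z \<Longrightarrow>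
      (f, f', f'') \<in> exact C \<Longrightarrow> (g, g', g'') \<in> exact C \<Longrightarrow> (g \<cdot> f, h', h'') \<in> exact C \<Longrightarrow>
      \<exists>u v. (u, v, amap (susp C) f' \<cdot> g'') \<in> exact C \<and>
        u \<in> Hom C (tgt C f') (tgt C h') \<and> v \<in> Hom C (tgt C h') (tgt C g') \<and>
        u \<cdot> f' = h' \<cdot> g \<and> h'' \<cdot> u = f'' \<and>
        v \<cdot> h' = g' \<and> g'' \<cdot> v = amap (susp C) f \<cdot> h''"

record ('o, 'm, 'p, 'n) tri_functor_data = "('o, 'm, 'p, 'n) functor_data" +
  susp_iso :: "'o \<Rightarrow> 'n"

locale triangle_functor =
  additive_functor C D F + dom: triangulated_category C + cod: triangulated_category D
  for C :: "('o, 'm) tri_cat" and D :: "('p, 'n) tri_cat"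
    and F :: "('o, 'm, 'p, 'n) tri_functor_data" +
  assumes susp_iso_natural:
      "natural_isomorphism C D (F \<circ>\<^sub>F susp C) (susp D \<circ>\<^sub>F F) (susp_iso F)"
    and amap_exact: "(f, g, h) \<in> exact C \<Longrightarrow>
      (amap F f, amap F g, susp_iso F (src C f) \<cdot>\<^bsub>D\<^esub> amap F h) \<in> exact D"


section \<open>Recollements\<close>

text \<open>
  The units \<open>\<psi>\<close>, \<open>\<eta>\<close> and counits \<open>\<epsilon>\<close>, \<open>\<phi>\<close> carry their usual names; the remaining
  unit or counit of each adjunction is written \<open>\<kappa>\<close> with the name of the left adjoint.
  That \<open>j i\<close> is isomorphic to the zero functor says that each \<open>j (i X')\<close> is a zero object.
\<close>

locale recollement =
  i: triangle_functor T' T i +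
  il: triangle_functor T T' il + ir: triangle_functor T T' ir +
  j: triangle_functor T T'' j +
  jl: triangle_functor T'' T jl + jr: triangle_functor T'' T jr +
  il_i: adjoint_pair T T' il i \<psi> \<kappa>il +
  i_ir: adjoint_pair T' T i ir \<kappa>i \<epsilon> +
  jl_j: adjoint_pair T'' T jl j \<kappa>jl \<phi> +
  j_jr: adjoint_pair T T'' j jr \<eta> \<kappa>j
  for T' :: "('o1, 'm1) tri_cat" and T :: "('o, 'm) tri_cat" and T'' :: "('o2, 'm2) tri_cat"
    and i :: "('o1, 'm1, 'o, 'm) tri_functor_data"
    and il ir :: "('o, 'm, 'o1, 'm1) tri_functor_data"
    and j :: "('o, 'm, 'o2, 'm2) tri_functor_data"
    and jl jr :: "('o2, 'm2, 'o, 'm) tri_functor_data"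
    and \<psi> :: "'o \<Rightarrow> 'm" and \<kappa>il :: "'o1 \<Rightarrow> 'm1"
    and \<kappa>i :: "'o1 \<Rightarrow> 'm1" and \<epsilon> :: "'o \<Rightarrow> 'm"
    and \<kappa>jl :: "'o2 \<Rightarrow> 'm2" and \<phi> :: "'o \<Rightarrow> 'm"
    and \<eta> :: "'o \<Rightarrow> 'm" and \<kappa>j :: "'o2 \<Rightarrow> 'm2" +
  assumes i_full: "full T' T i" and i_faithful: "faithful T' i"
    and jl_full: "full T'' T jl" and jl_faithful: "faithful T'' jl"
    and jr_full: "full T'' T jr" and jr_faithful: "faithful T'' jr"
    and j_i_zero: "X' \<in> obj T' \<Longrightarrow> zero_object T'' (omap j (omap i X'))"
    and triangle_i_ir: "X \<in> obj T \<Longrightarrow> \<exists>\<delta>. (\<epsilon> X, \<eta> X, \<delta>) \<in> exact T"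
    and triangle_jl_j: "X \<in> obj T \<Longrightarrow> \<exists>\<sigma>. (\<phi> X, \<psi> X, \<sigma>) \<in> exact T"


section \<open>Comma categories\<close>

text \<open>
  The comma category of \<open>F\<close> over \<open>D\<close>. An arrow records its source and target besides the pair
  \<open>(a, b)\<close>. Addition and zero arrows are componentwise.
\<close>

definition comma ::
    "('o, 'm, 'y) add_cat_scheme \<Rightarrow> ('p, 'n, 'z) add_cat_scheme
      \<Rightarrow> ('o, 'm, 'p, 'n, 'w) functor_data_scheme
      \<Rightarrow> ('o \<times> 'p \<times> 'n, ('o \<times> 'p \<times> 'n) \<times> ('o \<times> 'p \<times> 'n) \<times> ('m \<times> 'n)) add_cat" where
  "comma C D F =
    (let Ob = {(X, Y, f). X \<in> obj C \<and> Y \<in> obj D \<and> f \<in> Hom D (omap F X) Y} in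
    \<lparr>obj = Ob,
     arr = {((X, Y, f), (X', Y', f'), (a, b)).
       (X, Y, f) \<in> Ob \<and> (X', Y', f') \<in> Ob \<and> a \<in> Hom C X X' \<and> b \<in> Hom D Y Y' \<and>
       f' \<cdot>\<^bsub>D\<^esub> amap F a = b \<cdot>\<^bsub>D\<^esub> f},
     src = (\<lambda>(s, t, ab). s),
     tgt = (\<lambda>(s, t, ab). t),
     ident = (\<lambda>(X, Y, f). ((X, Y, f), (X, Y, f), (ident C X, ident D Y))),
     cmp = (\<lambda>(s', t', (a', b')) (s, t, (a, b)). (s, t', (a' \<cdot>\<^bsub>C\<^esub> a, b' \<cdot>\<^bsub>D\<^esub> b))),
     add = (\<lambda>(s, t, (a, b)) (s', t', (a', b')). (s, t, (a \<^bold>+\<^bsub>C\<^esub> a', b \<^bold>+\<^bsub>D\<^esub> b'))),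
     zero = (\<lambda>(X, Y, f) (X', Y', f'). ((X, Y, f), (X', Y', f'), (zero C X X', zero D Y Y')))\<rparr>)"

definition comma_functor ::
    "('o, 'm, 'z) cat_scheme \<Rightarrow> ('o, 'm, 'p, 'n, 'v) functor_data_scheme
      \<Rightarrow> ('o, 'm, 'q, 'l, 'w) functor_data_scheme \<Rightarrow> ('o \<Rightarrow> 'm)
      \<Rightarrow> ('o, 'm, 'p \<times> 'q \<times> 'l, ('p \<times> 'q \<times> 'l) \<times> ('p \<times> 'q \<times> 'l) \<times> ('n \<times> 'l)) functor_data" where
  "comma_functor T j ir \<phi> =
    (let \<Phi> = (\<lambda>X. (omap j X, omap ir X, amap ir (\<phi> X))) in
    \<lparr>omap = \<Phi>,
     amap = (\<lambda>f. (\<Phi> (src T f), \<Phi> (tgt T f), (amap j f, amap ir f)))\<rparr>)"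

end

theory Submission
  imports Defs
begin

text \<open>
  For every \<open>X\<close> the square with corners \<open>i ir jl j X\<close>, \<open>jl j X\<close>, \<open>i ir X\<close>, \<open>X\<close>, formed by counits of
  \<open>(i, ir)\<close> and by \<open>\<phi>\<close>, is a weak pushout, because its horizontal arrows have isomorphic cones
  \<open>jr j jl j X\<close> and \<open>jr j X\<close>. An arrow \<open>(a, b)\<close> from \<open>\<Phi> X\<close> to \<open>\<Phi> Y\<close> is a compatible pair of
  arrows from \<open>jl j X\<close> and \<open>i ir X\<close> to \<open>Y\<close>, so it lifts to an arrow from \<open>X\<close> to \<open>Y\<close>. Every object
  \<open>(M, N; f)\<close> is hit by the homotopy pushout of \<open>i f\<close> and the counit \<open>i ir jl M \<rightarrow> jl M\<close>. An arrow
  killed by \<open>j\<close> factors through the image of \<open>i\<close>, and its composite with an arrow killed by \<open>ir\<close>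
  vanishes. A full additive functor with square zero kernel detects isomorphisms.
\<close>

section \<open>Categories and functors\<close>

text \<open>The obstacle is that a triangulated category has only weak pushouts: fill-ins exist, but
  they are neither unique nor visibly invertible. Existence suffices for lifting arrows; the missing
  uniqueness is the source of the kernel ideal. Invertibility of the fill-in \<open>c\<close>
  between the two cones has to be earned: fullness of \<open>jr\<close> writes \<open>c\<close> as
  \<open>jr k\<close>, transposition along \<open>(j, jr)\<close> forces
  \<open>k = j (\<phi> X)\<close>, and this arrow is invertible because \<open>jl\<close> is fully
  faithful. For an arrow \<open>(a, b)\<close> the commuting square of the comma category says
  exactly that the transposes of \<open>a\<close> along \<open>(jl, j)\<close> and of
  \<open>b\<close> along \<open>(i, ir)\<close> agree on \<open>i ir jl j X\<close>. Since the
  suspension is only an autoequivalence, triangles are desuspended by its fullness, faithfulness and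
  density, and each rotation brings a sign to be tracked.\<close>

context category
begin

lemma in_Hom: "f \<in> Hom C X Y \<longleftrightarrow> f \<in> arr C \<and> src C f = X \<and> tgt C f = Y"
  by (simp add: Hom_def)

lemma Hom_obj: "f \<in> Hom C X Y \<Longrightarrow> X \<in> obj C \<and> Y \<in> obj C"
  using src_closed tgt_closed by (auto simp: in_Hom)

lemma src_tgt_obj [simp]:
  "f \<in> arr C \<Longrightarrow> src C f \<in> obj C"
  "f \<in> arr C \<Longrightarrow> tgt C f \<in> obj C"
  by (simp_all add: src_closed tgt_closed)

lemma ident_simps [simp]:
  assumes "X \<in> obj C"
  shows "ident C X \<in> arr C" "src C (ident C X) = X" "tgt C (ident C X) = X"
  using ident_closed[OF assms] by (simp_all add: in_Hom)

text \<open>Side conditions are equations between sources and targets: membership in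
  \<open>Hom\<close> would mention intermediate objects that the simplifier cannot guess from the
  conclusion.\<close>

lemma comp_simps [simp]:
  assumes "f \<in> arr C" "g \<in> arr C" "src C g = tgt C f"
  shows "g \<cdot> f \<in> arr C" "src C (g \<cdot> f) = src C f" "tgt C (g \<cdot> f) = tgt C g"
  using comp_closed[of f "src C f" "tgt C f" g "tgt C g"] assms by (simp_all add: in_Hom)

lemma comp_assoc' [simp]:
  assumes "f \<in> arr C" "g \<in> arr C" "h \<in> arr C" "src C g = tgt C f" "src C h = tgt C g"
  shows "(h \<cdot> g) \<cdot> f = h \<cdot> (g \<cdot> f)"
  using comp_assoc[of f "src C f" "tgt C f" g "tgt C g" h "tgt C h"] assms
  by (simp add: in_Hom)

lemma comp_ident_simps [simp]:
  "f \<in> arr C \<Longrightarrow> tgt C f = Y \<Longrightarrow> ident C Y \<cdot> f = f"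
  "f \<in> arr C \<Longrightarrow> src C f = X \<Longrightarrow> f \<cdot> ident C X = f"
  using comp_ident_left[of f "src C f" Y] comp_ident_right[of f X "tgt C f"]
  by (simp_all add: in_Hom)

text \<open>Composites are normalised to the right, where a known equation \<open>g f = k\<close> no
  longer matches inside \<open>g (f x)\<close>; this is its reassociated form.\<close>

lemma comp_cong_right:
  assumes "g \<cdot> f = k" "x \<in> arr C" "f \<in> arr C" "g \<in> arr C" "src C f = tgt C x" "src C g = tgt C f"
  shows "g \<cdot> (f \<cdot> x) = k \<cdot> x"
  using assms comp_assoc'[of x f g] by simp

lemma is_iso_arr: "is_iso C f \<Longrightarrow> f \<in> arr C"
  by (simp add: is_iso_def)

lemma is_isoE:
  assumes "is_iso C f"
  obtains g where "g \<in> arr C" "src C g = tgt C f" "tgt C g = src C f"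
    "g \<cdot> f = ident C (src C f)" "f \<cdot> g = ident C (tgt C f)"
  using assms unfolding is_iso_def Bex_def in_Hom by blast

text \<open>A left and a right inverse may be produced independently, since
  \<open>l = l f r = r\<close>.\<close>

lemma is_isoI:
  assumes f: "f \<in> Hom C X Y" and l: "l \<in> Hom C Y X" and r: "r \<in> Hom C Y X"
    and lf: "l \<cdot> f = ident C X" and fr: "f \<cdot> r = ident C Y"
  shows "is_iso C f"
proof -
  have "l = l \<cdot> (f \<cdot> r)" using l by (simp add: fr in_Hom)
  also have "\<dots> = r"
    using f l r comp_cong_right[OF lf, of r] by (simp add: in_Hom)
  finally have "f \<cdot> l = ident C Y" using fr by simp
  with f l lf show ?thesis unfolding is_iso_def by (intro conjI bexI[of _ l]) (simp_all add: in_Hom)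
qed

lemma is_iso_ident: "X \<in> obj C \<Longrightarrow> is_iso C (ident C X)"
  by (rule is_isoI[of _ X X "ident C X" "ident C X"]) (simp_all add: in_Hom)

lemma is_iso_comp:
  assumes "is_iso C f" "is_iso C g" "src C g = tgt C f"
  shows "is_iso C (g \<cdot> f)"
proof -
  obtain f' where f': "f' \<in> arr C" "src C f' = tgt C f" "tgt C f' = src C f"
    "f' \<cdot> f = ident C (src C f)" "f \<cdot> f' = ident C (tgt C f)"
    using assms(1) by (rule is_isoE)
  obtain g' where g': "g' \<in> arr C" "src C g' = tgt C g" "tgt C g' = src C g"
    "g' \<cdot> g = ident C (src C g)" "g \<cdot> g' = ident C (tgt C g)"
    using assms(2) by (rule is_isoE)
  have arr: "f \<in> arr C" "g \<in> arr C" using assms by (simp_all add: is_iso_arr)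
  have 1: "g' \<cdot> (g \<cdot> f) = f"
    using comp_cong_right[OF g'(4), of f] arr g' assms(3) by simp
  have 2: "f \<cdot> (f' \<cdot> g') = g'"
    using comp_cong_right[OF f'(5), of g'] arr g' f' assms(3) by simp
  show ?thesis
    by (rule is_isoI[of _ "src C f" "tgt C g" "f' \<cdot> g'" "f' \<cdot> g'"])
      (use arr f' g' assms(3) 1 2 in \<open>simp_all add: in_Hom\<close>)
qed

lemma is_iso_inverse:
  assumes "g \<in> Hom C Y X" "f \<in> Hom C X Y" "g \<cdot> f = ident C X" "f \<cdot> g = ident C Y"
  shows "is_iso C g" "is_iso C f"
  using assms unfolding is_iso_def
  by (intro conjI bexI[of _ f] bexI[of _ g]; simp add: in_Hom)+

lemma is_iso_cancel_left:
  assumes gf: "is_iso C (g \<cdot> f)" and g: "is_iso C g"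
    and f: "f \<in> arr C" and st: "src C g = tgt C f"
  shows "is_iso C f"
proof -
  obtain g' where g': "g' \<in> arr C" "src C g' = tgt C g" "tgt C g' = src C g"
    "g' \<cdot> g = ident C (src C g)" "g \<cdot> g' = ident C (tgt C g)"
    using g by (rule is_isoE)
  have "is_iso C g'" using is_iso_inverse(1)[of g' "tgt C g" "src C g" g] g' is_iso_arr[OF g]
    by (simp add: in_Hom)
  then have "is_iso C (g' \<cdot> (g \<cdot> f))"
    using gf g' f st is_iso_arr[OF g] by (intro is_iso_comp[of "g \<cdot> f" g']) simp_all
  moreover have "g' \<cdot> (g \<cdot> f) = f"
    using comp_cong_right[OF g'(4), of f] f g' is_iso_arr[OF g] st by simp
  ultimately show ?thesis by simp
qed

lemma is_iso_cancel_right: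
  assumes gf: "is_iso C (g \<cdot> f)" and f: "is_iso C f"
    and g: "g \<in> arr C" and st: "src C g = tgt C f"
  shows "is_iso C g"
proof -
  obtain f' where f': "f' \<in> arr C" "src C f' = tgt C f" "tgt C f' = src C f"
    "f' \<cdot> f = ident C (src C f)" "f \<cdot> f' = ident C (tgt C f)"
    using f by (rule is_isoE)
  have "is_iso C f'" using is_iso_inverse(1)[of f' "tgt C f" "src C f" f] f' is_iso_arr[OF f]
    by (simp add: in_Hom)
  then have "is_iso C ((g \<cdot> f) \<cdot> f')"
    using gf g f' st is_iso_arr[OF f] by (intro is_iso_comp[of f' "g \<cdot> f"]) simp_all
  then show ?thesis using f' g is_iso_arr[OF f] st by simp
qed

end

lemma comp_functor_simps [simp]:
  "omap (G \<circ>\<^sub>F F) X = omap G (omap F X)"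
  "amap (G \<circ>\<^sub>F F) f = amap G (amap F f)"
  by (simp_all add: comp_functor_def)

lemma id_functor_simps [simp]: "omap id_functor X = X" "amap id_functor f = f"
  by (simp_all add: id_functor_def)

context is_functor
begin

lemma amap_simps [simp]:
  assumes "f \<in> arr C"
  shows "amap F f \<in> arr D" "src D (amap F f) = omap F (src C f)"
    "tgt D (amap F f) = omap F (tgt C f)"
  using amap_closed[of f "src C f" "tgt C f"] assms by (simp_all add: Hom_def)

lemma amap_comp' [simp]:
  assumes "f \<in> arr C" "g \<in> arr C" "src C g = tgt C f"
  shows "amap F (g \<cdot>\<^bsub>C\<^esub> f) = amap F g \<cdot>\<^bsub>D\<^esub> amap F f"
  using amap_comp[of f "src C f" "tgt C f" g "tgt C g"] assms by (simp add: Hom_def)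

lemmas functor_simps [simp] = omap_closed amap_ident

lemma is_iso_amap:
  assumes "is_iso C f"
  shows "is_iso D (amap F f)"
proof -
  obtain g where g: "g \<in> arr C" "src C g = tgt C f" "tgt C g = src C f"
    "g \<cdot>\<^bsub>C\<^esub> f = ident C (src C f)" "f \<cdot>\<^bsub>C\<^esub> g = ident C (tgt C f)"
    using assms by (rule dom.is_isoE)
  have f: "f \<in> arr C" using assms by (rule dom.is_iso_arr)
  have "amap F g \<cdot>\<^bsub>D\<^esub> amap F f = amap F (g \<cdot>\<^bsub>C\<^esub> f)"
    "amap F f \<cdot>\<^bsub>D\<^esub> amap F g = amap F (f \<cdot>\<^bsub>C\<^esub> g)"
    using f g(1-3) by simp_all
  then show ?thesis
    using f g by (intro cod.is_iso_inverse(1)[of _ "omap F (tgt C f)" "omap F (src C f)" "amap F g"]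
      cod.is_iso_inverse(2)[of "amap F g" "omap F (tgt C f)" "omap F (src C f)"])
      (simp_all add: cod.in_Hom)
qed

end

context natural_transformation
begin

lemma component_simps [simp]:
  assumes "X \<in> obj C"
  shows "\<alpha> X \<in> arr D" "src D (\<alpha> X) = omap F X" "tgt D (\<alpha> X) = omap G X"
  using component_closed[OF assms] by (simp_all add: Hom_def)

lemma naturality':
  "f \<in> arr C \<Longrightarrow> \<alpha> (tgt C f) \<cdot>\<^bsub>D\<^esub> amap F f = amap G f \<cdot>\<^bsub>D\<^esub> \<alpha> (src C f)"
  using naturality[of f "src C f" "tgt C f"] by (simp add: Hom_def)

end

context adjoint_pair
begin

text \<open>The inverse of the unit at \<open>X\<close> is the preimage under \<open>F\<close> of the counit at \<open>F X\<close>.\<close>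

lemma is_iso_unit:
  assumes "full C D F" "faithful C F" and X: "X \<in> obj C"
  shows "is_iso C (\<eta> X)"
proof -
  have "\<epsilon> (omap F X) \<in> Hom D (omap F (omap G (omap F X))) (omap F X)"
    using counit.component_closed[of "omap F X"] X by simp
  then obtain k where k: "k \<in> Hom C (omap G (omap F X)) X" "amap F k = \<epsilon> (omap F X)"
    using \<open>full C D F\<close> X unfolding full_def by fastforce
  then have k': "k \<in> arr C" "src C k = omap G (omap F X)" "tgt C k = X"
    by (simp_all add: Hom_def)
  have "amap F (k \<cdot>\<^bsub>C\<^esub> \<eta> X) = amap F (ident C X)"
    using k' X triangle_left[OF X] k(2) by simp
  then have 1: "k \<cdot>\<^bsub>C\<^esub> \<eta> X = ident C X"
    using \<open>faithful C F\<close> X k' unfolding faithful_def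
    by (auto simp: inj_on_def Hom_def)
  \<comment> \<open>Naturality of the unit at \<open>k\<close> exposes \<open>G (F k)\<close>, which
    is \<open>G\<close> of the counit at \<open>F X\<close>, so the second triangle identity
    applies.\<close>
  have "\<eta> X \<cdot>\<^bsub>C\<^esub> k = amap G (amap F k) \<cdot>\<^bsub>C\<^esub> \<eta> (omap G (omap F X))"
    using unit.naturality'[of k] k' by simp
  also have "\<dots> = ident C (omap G (omap F X))"
    using triangle_right[of "omap F X"] k(2) X by simp
  finally show ?thesis
    using 1 k X by (intro left.dom.is_iso_inverse(2)[of k "omap G (omap F X)" X])
      (simp_all add: Hom_def)
qed

end

section \<open>Preadditive categories\<close>

context preadditive_category
begin

lemma add_simps [simp]:
  assumes "f \<in> arr C" "g \<in> arr C" "src C g = src C f" "tgt C g = tgt C f"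
  shows "f \<^bold>+ g \<in> arr C" "src C (f \<^bold>+ g) = src C f" "tgt C (f \<^bold>+ g) = tgt C f"
proof -
  interpret comm_group "hom_group C (src C f) (tgt C f)"
    using assms by (intro hom_comm_group) simp_all
  show "f \<^bold>+ g \<in> arr C" "src C (f \<^bold>+ g) = src C f" "tgt C (f \<^bold>+ g) = tgt C f"
    using m_closed[of f g] assms by (simp_all add: hom_group_def in_Hom)
qed

lemma zero_simps [simp]:
  assumes "X \<in> obj C" "Y \<in> obj C"
  shows "zero C X Y \<in> arr C" "src C (zero C X Y) = X" "tgt C (zero C X Y) = Y"
proof -
  interpret comm_group "hom_group C X Y"
    using assms by (rule hom_comm_group)
  show "zero C X Y \<in> arr C" "src C (zero C X Y) = X" "tgt C (zero C X Y) = Y"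
    using one_closed by (simp_all add: hom_group_def in_Hom)
qed

lemma neg_simps [simp]:
  assumes "f \<in> arr C"
  shows "neg C f \<in> arr C" "src C (neg C f) = src C f" "tgt C (neg C f) = tgt C f"
proof -
  interpret comm_group "hom_group C (src C f) (tgt C f)"
    using assms by (intro hom_comm_group) simp_all
  have "neg C f \<in> Hom C (src C f) (tgt C f)"
    unfolding neg_def using inv_closed[of f] assms by (simp add: hom_group_def in_Hom)
  then show "neg C f \<in> arr C" "src C (neg C f) = src C f" "tgt C (neg C f) = tgt C f"
    by (simp_all add: in_Hom)
qed

lemma add_assoc:
  assumes "f \<in> arr C" "g \<in> arr C" "src C g = src C f" "tgt C g = tgt C f"
    "h \<in> arr C" "src C h = src C f" "tgt C h = tgt C f"
  shows "f \<^bold>+ g \<^bold>+ h = f \<^bold>+ (g \<^bold>+ h)"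
proof -
  interpret comm_group "hom_group C (src C f) (tgt C f)"
    using assms by (intro hom_comm_group) simp_all
  show ?thesis using m_assoc[of f g h] assms by (simp add: hom_group_def in_Hom)
qed

lemma add_commute:
  assumes "f \<in> arr C" "g \<in> arr C" "src C g = src C f" "tgt C g = tgt C f"
  shows "f \<^bold>+ g = g \<^bold>+ f"
proof -
  interpret comm_group "hom_group C (src C f) (tgt C f)"
    using assms by (intro hom_comm_group) simp_all
  show ?thesis using m_comm[of f g] assms by (simp add: hom_group_def in_Hom)
qed

lemma add_zero_neg [simp]:
  assumes "f \<in> arr C"
  shows "src C f = X \<Longrightarrow> tgt C f = Y \<Longrightarrow> f \<^bold>+ zero C X Y = f"
    "src C f = X \<Longrightarrow> tgt C f = Y \<Longrightarrow> zero C X Y \<^bold>+ f = f"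
    "f \<^bold>+ neg C f = zero C (src C f) (tgt C f)"
    "neg C f \<^bold>+ f = zero C (src C f) (tgt C f)"
    "neg C (neg C f) = f"
proof -
  interpret comm_group "hom_group C (src C f) (tgt C f)"
    using assms by (intro hom_comm_group) simp_all
  have f: "f \<in> carrier (hom_group C (src C f) (tgt C f))"
    using assms by (simp add: hom_group_def in_Hom)
  show "src C f = X \<Longrightarrow> tgt C f = Y \<Longrightarrow> f \<^bold>+ zero C X Y = f"
    "src C f = X \<Longrightarrow> tgt C f = Y \<Longrightarrow> zero C X Y \<^bold>+ f = f"
    "f \<^bold>+ neg C f = zero C (src C f) (tgt C f)"
    "neg C f \<^bold>+ f = zero C (src C f) (tgt C f)"
    using r_one[OF f] l_one[OF f] r_inv[OF f] l_inv[OF f] by (auto simp: hom_group_def neg_def)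
  show "neg C (neg C f) = f"
    using inv_inv[OF f] neg_simps[OF assms] unfolding neg_def by simp
qed

lemma neg_unique:
  assumes "f \<in> arr C" "g \<in> arr C" "src C g = src C f" "tgt C g = tgt C f"
    "f \<^bold>+ g = zero C (src C f) (tgt C f)"
  shows "g = neg C f"
proof -
  have "neg C f = neg C f \<^bold>+ (f \<^bold>+ g)" using assms by simp
  also have "\<dots> = (neg C f \<^bold>+ f) \<^bold>+ g" using assms by (intro add_assoc[symmetric]) simp_all
  also have "\<dots> = g" using assms(1-4) by simp
  finally show ?thesis by simp
qed

lemma add_neg_cancel:
  assumes "f \<in> arr C" "g \<in> arr C" "src C g = src C f" "tgt C g = tgt C f"
  shows "g \<^bold>+ (f \<^bold>+ neg C g) = f"
proof -
  have "g \<^bold>+ (f \<^bold>+ neg C g) = g \<^bold>+ (neg C g \<^bold>+ f)"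
    using assms add_commute[of f "neg C g"] by (intro arg_cong[of _ _ "add C g"]) simp
  also have "\<dots> = (g \<^bold>+ neg C g) \<^bold>+ f" using assms by (intro add_assoc[symmetric]) simp_all
  also have "\<dots> = f" using assms by simp
  finally show ?thesis .
qed

lemma eq_iff_diff:
  assumes "f \<in> arr C" "g \<in> arr C" "src C g = src C f" "tgt C g = tgt C f"
    "f \<^bold>+ neg C g = zero C (src C f) (tgt C f)"
  shows "f = g"
  using add_neg_cancel[of f g] assms by simp

lemma comp_add_right:
  assumes "f \<in> arr C" "f' \<in> arr C" "src C f' = src C f" "tgt C f' = tgt C f"
    "g \<in> arr C" "src C g = tgt C f"
  shows "g \<cdot> (f \<^bold>+ f') = g \<cdot> f \<^bold>+ g \<cdot> f'"
  using comp_additive_right[of g "tgt C f" "tgt C g" "src C f"] assms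
  by (simp add: hom_def hom_group_def in_Hom)

lemma comp_add_left:
  assumes "g \<in> arr C" "g' \<in> arr C" "src C g' = src C g" "tgt C g' = tgt C g"
    "f \<in> arr C" "src C g = tgt C f"
  shows "(g \<^bold>+ g') \<cdot> f = g \<cdot> f \<^bold>+ g' \<cdot> f"
  using comp_additive_left[of f "src C f" "tgt C f" "tgt C g"] assms
  by (simp add: hom_def hom_group_def in_Hom)

text \<open>This turns additivity into preservation of zero arrows, both for composition and for
  additive functors.\<close>

lemma add_self_zero:
  assumes "f \<in> arr C" "f \<^bold>+ f = f"
  shows "f = zero C (src C f) (tgt C f)"
proof -
  have "f = f \<^bold>+ f \<^bold>+ neg C f" using assms by (subst add_assoc) simp_all
  also have "\<dots> = zero C (src C f) (tgt C f)" using assms by simp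
  finally show ?thesis .
qed

lemma comp_zero_right [simp]:
  assumes "g \<in> arr C" "X \<in> obj C" "src C g = Y"
  shows "g \<cdot> zero C X Y = zero C X (tgt C g)"
  using assms comp_add_right[of "zero C X Y" "zero C X Y" g]
    add_self_zero[of "g \<cdot> zero C X Y"] src_closed by auto

lemma comp_zero_left [simp]:
  assumes "f \<in> arr C" "Z \<in> obj C" "tgt C f = Y"
  shows "zero C Y Z \<cdot> f = zero C (src C f) Z"
  using assms comp_add_left[of "zero C Y Z" "zero C Y Z" f]
    add_self_zero[of "zero C Y Z \<cdot> f"] tgt_closed by auto

lemma comp_neg_right [simp]:
  assumes "f \<in> arr C" "g \<in> arr C" "src C g = tgt C f"
  shows "g \<cdot> neg C f = neg C (g \<cdot> f)"
  by (rule neg_unique) (use assms comp_add_right[of f "neg C f" g] in simp_all)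

lemma comp_neg_left [simp]:
  assumes "f \<in> arr C" "g \<in> arr C" "src C g = tgt C f"
  shows "neg C g \<cdot> f = neg C (g \<cdot> f)"
  by (rule neg_unique) (use assms comp_add_left[of g "neg C g" f] in simp_all)

lemma neg_zero [simp]: "X \<in> obj C \<Longrightarrow> Y \<in> obj C \<Longrightarrow> neg C (zero C X Y) = zero C X Y"
  using neg_unique[of "zero C X Y" "zero C X Y"] by simp

lemma neg_eq_iff:
  assumes "f \<in> arr C" "g \<in> arr C"
  shows "neg C f = neg C g \<longleftrightarrow> f = g"
  by (metis add_zero_neg(5) assms)

lemma zero_objectD:
  assumes "zero_object C Z"
  shows "Z \<in> obj C" "f \<in> arr C \<Longrightarrow> src C f = Z \<Longrightarrow> f = zero C Z (tgt C f)"
    "f \<in> arr C \<Longrightarrow> tgt C f = Z \<Longrightarrow> f = zero C (src C f) Z"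
proof -
  show Z: "Z \<in> obj C" using assms by (simp add: zero_object_def)
  show "f = zero C Z (tgt C f)" if "f \<in> arr C" "src C f = Z"
  proof -
    have "\<exists>!f'. f' \<in> Hom C Z (tgt C f)" using assms that by (simp add: zero_object_def)
    moreover have "f \<in> Hom C Z (tgt C f)" "zero C Z (tgt C f) \<in> Hom C Z (tgt C f)"
      using that Z by (simp_all add: in_Hom)
    ultimately show ?thesis by blast
  qed
  show "f = zero C (src C f) Z" if "f \<in> arr C" "tgt C f = Z"
  proof -
    have "\<exists>!f'. f' \<in> Hom C (src C f) Z" using assms that by (simp add: zero_object_def)
    moreover have "f \<in> Hom C (src C f) Z" "zero C (src C f) Z \<in> Hom C (src C f) Z"
      using that Z by (simp_all add: in_Hom)
    ultimately show ?thesis by blast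
  qed
qed

text \<open>Every arrow into or out of \<open>Z\<close> is a composite with the identity of
  \<open>Z\<close>, hence zero. The criterion is equational, so additive functors preserve
  it.\<close>

lemma zero_objectI:
  assumes "Z \<in> obj C" "ident C Z = zero C Z Z"
  shows "zero_object C Z"
proof -
  have 1: "f = zero C Z X" if "f \<in> Hom C Z X" for f X
  proof -
    have "f = f \<cdot> ident C Z" using that assms(1) by (simp add: in_Hom)
    also have "\<dots> = zero C Z X" unfolding assms(2) using that assms(1) by (simp add: in_Hom)
    finally show ?thesis .
  qed
  have 2: "f = zero C X Z" if "f \<in> Hom C X Z" for f X
  proof -
    have "f = ident C Z \<cdot> f" using that assms(1) by (simp add: in_Hom)
    also have "\<dots> = zero C X Z" unfolding assms(2) using that assms(1) by (simp add: in_Hom)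
    finally show ?thesis .
  qed
  have "(\<exists>!f. f \<in> Hom C X Z) \<and> (\<exists>!f. f \<in> Hom C Z X)" if "X \<in> obj C" for X
    using that assms(1) by (intro conjI ex1I[of _ "zero C X Z"] ex1I[of _ "zero C Z X"] 1 2)
      (simp_all add: in_Hom)
  then show ?thesis using assms(1) by (simp add: zero_object_def)
qed

lemma zero_object_ident: "zero_object C Z \<Longrightarrow> ident C Z = zero C Z Z"
  using zero_objectD(1)[of Z] zero_objectD(2)[of Z "ident C Z"] by simp

end

context additive_functor
begin

lemma amap_add:
  assumes "f \<in> arr C" "g \<in> arr C" "src C g = src C f" "tgt C g = tgt C f"
  shows "amap F (f \<^bold>+\<^bsub>C\<^esub> g) = amap F f \<^bold>+\<^bsub>D\<^esub> amap F g"
  using amap_additive[of "src C f" "tgt C f"] assms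
  by (simp add: hom_def hom_group_def dom.in_Hom)

lemma amap_zero [simp]:
  assumes "X \<in> obj C" "Y \<in> obj C"
  shows "amap F (zero C X Y) = zero D (omap F X) (omap F Y)"
  using assms amap_add[of "zero C X Y" "zero C X Y"] cod.add_self_zero[of "amap F (zero C X Y)"]
  by simp

lemma amap_neg [simp]:
  assumes "f \<in> arr C"
  shows "amap F (neg C f) = neg D (amap F f)"
  by (rule cod.neg_unique) (use assms amap_add[of f "neg C f"] in simp_all)

lemma zero_object_omap:
  assumes "zero_object C Z"
  shows "zero_object D (omap F Z)"
  using dom.zero_objectD(1)[OF assms] dom.zero_object_ident[OF assms]
    amap_ident[of Z] amap_zero[of Z Z]
  by (intro cod.zero_objectI) simp_all

text \<open>If \<open>g\<close> lifts the inverse of \<open>F f\<close>, then \<open>n = g f - 1\<close> lies in the kernel ideal, so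
  \<open>1 - n\<close> inverts \<open>1 + n = g f\<close>; likewise for \<open>f g\<close>.\<close>

lemma detects_isos_if_square_zero:
  assumes "full C D F" and sq: "square_zero C (kernel_ideal C D F)"
  shows "detects_isos C D F"
  unfolding detects_isos_def
proof (intro ballI impI)
  have unip: "\<exists>l. l \<in> Hom C X X \<and> l \<cdot>\<^bsub>C\<^esub> e = ident C X \<and> e \<cdot>\<^bsub>C\<^esub> l = ident C X"
    if e: "e \<in> Hom C X X" "amap F e = ident D (omap F X)" for e X
  proof -
    have e': "e \<in> arr C" "src C e = X" "tgt C e = X" and X: "X \<in> obj C"
      using e dom.Hom_obj by (auto simp: dom.in_Hom)
    define n where "n = e \<^bold>+\<^bsub>C\<^esub> neg C (ident C X)"
    have n: "n \<in> arr C" "src C n = X" "tgt C n = X" using e' X by (simp_all add: n_def)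
    have "n \<in> kernel_ideal C D F"
      using e' X n e(2) by (simp add: kernel_ideal_def) (simp add: n_def amap_add)
    then have nn: "n \<cdot>\<^bsub>C\<^esub> n = zero C X X"
      using sq[unfolded square_zero_def, rule_format, of n n] n by simp
    have en: "e = ident C X \<^bold>+\<^bsub>C\<^esub> n" using e' X by (simp add: n_def dom.add_neg_cancel)
    define l where "l = ident C X \<^bold>+\<^bsub>C\<^esub> neg C n"
    have "l \<cdot>\<^bsub>C\<^esub> e = ident C X" "e \<cdot>\<^bsub>C\<^esub> l = ident C X"
      using n X nn unfolding en l_def
      by (simp_all add: dom.comp_add_left dom.comp_add_right dom.add_assoc)
    moreover have "l \<in> Hom C X X" using n X by (simp add: l_def dom.in_Hom)
    ultimately show ?thesis by blast
  qed
  fix f assume f: "f \<in> arr C" and iso: "is_iso D (amap F f)"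
  define X Y where "X = src C f" and "Y = tgt C f"
  have XY: "X \<in> obj C" "Y \<in> obj C" using f by (simp_all add: X_def Y_def)
  obtain g' where g': "g' \<in> arr D" "src D g' = omap F Y" "tgt D g' = omap F X"
    "g' \<cdot>\<^bsub>D\<^esub> amap F f = ident D (omap F X)" "amap F f \<cdot>\<^bsub>D\<^esub> g' = ident D (omap F Y)"
    using iso by (rule cod.is_isoE) (use f in \<open>simp add: X_def Y_def\<close>)
  then have "g' \<in> Hom D (omap F Y) (omap F X)" by (simp add: cod.in_Hom)
  then obtain g where g: "g \<in> Hom C Y X" "amap F g = g'"
    using \<open>full C D F\<close> XY unfolding full_def by fastforce
  have f': "f \<in> Hom C X Y" using f by (simp add: X_def Y_def dom.in_Hom)
  have st: "f \<in> arr C" "src C f = X" "tgt C f = Y" "g \<in> arr C" "src C g = Y" "tgt C g = X"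
    using f' g by (simp_all add: dom.in_Hom)
  obtain l where l: "l \<in> Hom C X X" "l \<cdot>\<^bsub>C\<^esub> (g \<cdot>\<^bsub>C\<^esub> f) = ident C X"
    using unip[of "g \<cdot>\<^bsub>C\<^esub> f" X] st g g' by (auto simp: dom.in_Hom)
  obtain r where r: "r \<in> Hom C Y Y" "(f \<cdot>\<^bsub>C\<^esub> g) \<cdot>\<^bsub>C\<^esub> r = ident C Y"
    using unip[of "f \<cdot>\<^bsub>C\<^esub> g" Y] st g g' by (auto simp: dom.in_Hom)
  \<comment> \<open>Correcting \<open>g f\<close> yields a left inverse of \<open>f\<close> and
    correcting \<open>f g\<close> a right inverse; \<open>is_isoI\<close> does not require them to
    be given as equal.\<close>
  show "is_iso C f"
    by (rule dom.is_isoI[of _ X Y "l \<cdot>\<^bsub>C\<^esub> g" "g \<cdot>\<^bsub>C\<^esub> r"])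
      (use l r st in \<open>simp_all add: dom.in_Hom\<close>)
qed

end

section \<open>Comma categories\<close>

lemma comma_simps [simp]:
  "src (comma C D F) (s, t, ab) = s"
  "tgt (comma C D F) (s, t, ab) = t"
  "ident (comma C D F) (X, Y, f) = ((X, Y, f), (X, Y, f), (ident C X, ident D Y))"
  "cmp (comma C D F) (s', t', (a', b')) (s, t, (a, b)) = (s, t', (cmp C a' a, cmp D b' b))"
  "add (comma C D F) (s, t, (a, b)) (s', t', (a', b')) = (s, t, (add C a a', add D b b'))"
  "zero (comma C D F) (X, Y, f) (X', Y', f') = ((X, Y, f), (X', Y', f'), (zero C X X', zero D Y Y'))"
  by (simp_all add: comma_def Let_def)

lemma comma_obj_iff:
  "(X, Y, f) \<in> obj (comma C D F) \<longleftrightarrow> X \<in> obj C \<and> Y \<in> obj D \<and> f \<in> Hom D (omap F X) Y"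
  by (simp add: comma_def Let_def)

lemma comma_arr_iff:
  "((X, Y, f), (X', Y', f'), (a, b)) \<in> arr (comma C D F) \<longleftrightarrow>
    (X, Y, f) \<in> obj (comma C D F) \<and> (X', Y', f') \<in> obj (comma C D F) \<and>
    a \<in> Hom C X X' \<and> b \<in> Hom D Y Y' \<and> cmp D f' (amap F a) = cmp D b f"
  by (simp add: comma_def Let_def)

lemma comma_HomE:
  assumes "h \<in> Hom (comma C D F) s t"
  obtains X Y f X' Y' f' a b where "s = (X, Y, f)" "t = (X', Y', f')" "h = (s, t, (a, b))"
    "(X, Y, f) \<in> obj (comma C D F)" "(X', Y', f') \<in> obj (comma C D F)"
    "a \<in> Hom C X X'" "b \<in> Hom D Y Y'" "cmp D f' (amap F a) = cmp D b f"
  using assms by (cases h; cases s; cases t) (auto simp: Hom_def comma_arr_iff)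

lemma comma_HomI:
  assumes "(X, Y, f) \<in> obj (comma C D F)" "(X', Y', f') \<in> obj (comma C D F)"
    "a \<in> Hom C X X'" "b \<in> Hom D Y Y'" "cmp D f' (amap F a) = cmp D b f"
  shows "((X, Y, f), (X', Y', f'), (a, b)) \<in> Hom (comma C D F) (X, Y, f) (X', Y', f')"
  using assms by (simp add: Hom_def comma_arr_iff)

context additive_functor
begin

lemma category_comma: "category (comma C D F)"
proof
  fix h assume "h \<in> arr (comma C D F)"
  then have "h \<in> Hom (comma C D F) (src (comma C D F) h) (tgt (comma C D F) h)"
    by (simp add: Hom_def)
  then show "src (comma C D F) h \<in> obj (comma C D F)" "tgt (comma C D F) h \<in> obj (comma C D F)"
    by (auto elim: comma_HomE)
next
  fix s assume s: "s \<in> obj (comma C D F)"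
  obtain X Y f where [simp]: "s = (X, Y, f)" by (cases s)
  show "ident (comma C D F) s \<in> Hom (comma C D F) s s"
    unfolding \<open>s = _\<close> comma_simps
    by (rule comma_HomI) (use s in \<open>simp_all add: comma_obj_iff dom.in_Hom cod.in_Hom\<close>)
next
  fix h h' r s t
  assume "h \<in> Hom (comma C D F) r s"
  then obtain X Y f X' Y' f' a b where h: "r = (X, Y, f)" "s = (X', Y', f')" "h = (r, s, (a, b))"
    "(X, Y, f) \<in> obj (comma C D F)" "(X', Y', f') \<in> obj (comma C D F)"
    "a \<in> Hom C X X'" "b \<in> Hom D Y Y'" "f' \<cdot>\<^bsub>D\<^esub> amap F a = b \<cdot>\<^bsub>D\<^esub> f"
    by (rule comma_HomE)
  assume "h' \<in> Hom (comma C D F) s t"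
  then obtain X'' Y'' f'' a' b' where h': "t = (X'', Y'', f'')" "h' = (s, t, (a', b'))"
    "(X'', Y'', f'') \<in> obj (comma C D F)"
    "a' \<in> Hom C X' X''" "b' \<in> Hom D Y' Y''" "f'' \<cdot>\<^bsub>D\<^esub> amap F a' = b' \<cdot>\<^bsub>D\<^esub> f'"
    using h(2) by (auto elim: comma_HomE)
  have a: "a \<in> arr C" "src C a = X" "tgt C a = X'" "a' \<in> arr C" "src C a' = X'" "tgt C a' = X''"
    "b \<in> arr D" "src D b = Y" "tgt D b = Y'" "b' \<in> arr D" "src D b' = Y'" "tgt D b' = Y''"
    using h h' by (simp_all add: dom.in_Hom cod.in_Hom)
  have f: "f \<in> arr D" "src D f = omap F X" "tgt D f = Y" "f' \<in> arr D" "src D f' = omap F X'"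
    "tgt D f' = Y'" "f'' \<in> arr D" "src D f'' = omap F X''" "tgt D f'' = Y''"
    using h h' by (simp_all add: comma_obj_iff cod.in_Hom)
  have "f'' \<cdot>\<^bsub>D\<^esub> (amap F a' \<cdot>\<^bsub>D\<^esub> amap F a) = (b' \<cdot>\<^bsub>D\<^esub> f') \<cdot>\<^bsub>D\<^esub> amap F a"
    by (rule cod.comp_cong_right) (use h'(6) a f in simp_all)
  also have "\<dots> = b' \<cdot>\<^bsub>D\<^esub> (b \<cdot>\<^bsub>D\<^esub> f)" using h(8) a f by simp
  finally have "f'' \<cdot>\<^bsub>D\<^esub> (amap F a' \<cdot>\<^bsub>D\<^esub> amap F a) = b' \<cdot>\<^bsub>D\<^esub> (b \<cdot>\<^bsub>D\<^esub> f)" .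
  then show "cmp (comma C D F) h' h \<in> Hom (comma C D F) r t"
    unfolding h(1-3) h'(1,2) comma_simps
    by (intro comma_HomI) (use h h' a f in \<open>simp_all add: dom.in_Hom cod.in_Hom\<close>)
next
  fix h h' h'' q r s t
  assume "h \<in> Hom (comma C D F) q r" "h' \<in> Hom (comma C D F) r s" "h'' \<in> Hom (comma C D F) s t"
  then show "cmp (comma C D F) (cmp (comma C D F) h'' h') h =
      cmp (comma C D F) h'' (cmp (comma C D F) h' h)"
    by (elim comma_HomE) (auto simp: dom.in_Hom cod.in_Hom)
next
  fix h s t
  assume "h \<in> Hom (comma C D F) s t"
  then show "cmp (comma C D F) (ident (comma C D F) t) h = h"
    "cmp (comma C D F) h (ident (comma C D F) s) = h"
    by (auto elim!: comma_HomE simp: dom.in_Hom cod.in_Hom)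
qed

text \<open>Additivity of \<open>F\<close> makes the sum of two commuting squares commute; the group
  laws and bilinearity then hold componentwise. The kernel ideal of a functor into the comma
  category refers to these zero arrows.\<close>

lemma preadditive_comma: "preadditive_category (comma C D F)"
proof -
  interpret K: category "comma C D F" by (rule category_comma)
  have add_closed: "add (comma C D F) h h' \<in> Hom (comma C D F) s t"
    if hh': "h \<in> Hom (comma C D F) s t" "h' \<in> Hom (comma C D F) s t" for h h' s t
  proof -
    obtain X Y f X' Y' f' a b where h: "s = (X, Y, f)" "t = (X', Y', f')" "h = (s, t, (a, b))"
      "(X, Y, f) \<in> obj (comma C D F)" "(X', Y', f') \<in> obj (comma C D F)"
      "a \<in> Hom C X X'" "b \<in> Hom D Y Y'" "f' \<cdot>\<^bsub>D\<^esub> amap F a = b \<cdot>\<^bsub>D\<^esub> f"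
      using hh'(1) by (rule comma_HomE)
    obtain a' b' where h': "h' = (s, t, (a', b'))"
      "a' \<in> Hom C X X'" "b' \<in> Hom D Y Y'" "f' \<cdot>\<^bsub>D\<^esub> amap F a' = b' \<cdot>\<^bsub>D\<^esub> f"
      using hh'(2) h(1,2) by (auto elim: comma_HomE)
    show ?thesis
      unfolding h(1-3) h'(1) comma_simps
      by (rule comma_HomI)
        (use h h' in \<open>simp_all add: dom.in_Hom cod.in_Hom comma_obj_iff amap_add
          cod.comp_add_left cod.comp_add_right\<close>)
  qed
  have zero_closed: "zero (comma C D F) s t \<in> Hom (comma C D F) s t"
    if st: "s \<in> obj (comma C D F)" "t \<in> obj (comma C D F)" for s t
  proof -
    obtain X Y f X' Y' f' where h: "s = (X, Y, f)" "t = (X', Y', f')" by (cases s; cases t)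
    show ?thesis unfolding h comma_simps
      by (rule comma_HomI)
        (use st h in \<open>simp_all add: dom.in_Hom cod.in_Hom comma_obj_iff\<close>)
  qed
  show ?thesis
  proof (intro preadditive_category.intro preadditive_category_axioms.intro category_comma)
    fix s t assume st: "s \<in> obj (comma C D F)" "t \<in> obj (comma C D F)"
    show "comm_group (hom_group (comma C D F) s t)"
    proof (rule comm_groupI, unfold hom_group_def monoid.simps partial_object.simps)
      fix h h' assume hh': "h \<in> Hom (comma C D F) s t" "h' \<in> Hom (comma C D F) s t"
      show "add (comma C D F) h h' \<in> Hom (comma C D F) s t" using hh' by (rule add_closed)
      show "add (comma C D F) h h' = add (comma C D F) h' h"
        using hh' by (elim comma_HomE) (simp add: dom.in_Hom cod.in_Hom dom.add_commute cod.add_commute)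
      fix h'' assume "h'' \<in> Hom (comma C D F) s t"
      then show "add (comma C D F) (add (comma C D F) h h') h'' =
          add (comma C D F) h (add (comma C D F) h' h'')"
        using hh' by (elim comma_HomE) (simp add: dom.in_Hom cod.in_Hom dom.add_assoc cod.add_assoc)
    next
      show "zero (comma C D F) s t \<in> Hom (comma C D F) s t" using st by (rule zero_closed)
    next
      fix h assume "h \<in> Hom (comma C D F) s t"
      then obtain X Y f X' Y' f' a b where h: "s = (X, Y, f)" "t = (X', Y', f')" "h = (s, t, (a, b))"
        "(X, Y, f) \<in> obj (comma C D F)" "(X', Y', f') \<in> obj (comma C D F)"
        "a \<in> Hom C X X'" "b \<in> Hom D Y Y'" "f' \<cdot>\<^bsub>D\<^esub> amap F a = b \<cdot>\<^bsub>D\<^esub> f"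
        by (rule comma_HomE)
      show "add (comma C D F) (zero (comma C D F) s t) h = h"
        using h by (simp add: dom.in_Hom cod.in_Hom)
      have "(s, t, (neg C a, neg D b)) \<in> Hom (comma C D F) s t"
        unfolding h(1,2)
        by (rule comma_HomI) (use h in \<open>simp_all add: dom.in_Hom cod.in_Hom comma_obj_iff\<close>)
      moreover have "add (comma C D F) (s, t, (neg C a, neg D b)) h = zero (comma C D F) s t"
        using h by (simp add: dom.in_Hom cod.in_Hom)
      ultimately show "\<exists>k\<in>Hom (comma C D F) s t. add (comma C D F) k h = zero (comma C D F) s t"
        by blast
    qed
  next
    fix h r s t assume h: "h \<in> Hom (comma C D F) r s" and t: "t \<in> obj (comma C D F)"
    show "(\<lambda>g. cmp (comma C D F) g h) \<in>
        hom (hom_group (comma C D F) s t) (hom_group (comma C D F) r t)"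
    proof (rule homI, unfold hom_group_def monoid.simps partial_object.simps)
      fix g assume g: "g \<in> Hom (comma C D F) s t"
      show "cmp (comma C D F) g h \<in> Hom (comma C D F) r t" using h g by (rule K.comp_closed)
      fix g' assume "g' \<in> Hom (comma C D F) s t"
      with g h show "cmp (comma C D F) (add (comma C D F) g g') h =
          add (comma C D F) (cmp (comma C D F) g h) (cmp (comma C D F) g' h)"
        by (elim comma_HomE)
          (simp add: dom.in_Hom cod.in_Hom dom.comp_add_left cod.comp_add_left)
    qed
  next
    fix h r s t assume h: "h \<in> Hom (comma C D F) s t" and r: "r \<in> obj (comma C D F)"
    show "(\<lambda>g. cmp (comma C D F) h g) \<in>
        hom (hom_group (comma C D F) r s) (hom_group (comma C D F) r t)"
    proof (rule homI, unfold hom_group_def monoid.simps partial_object.simps)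
      fix g assume g: "g \<in> Hom (comma C D F) r s"
      show "cmp (comma C D F) h g \<in> Hom (comma C D F) r t" using g h by (rule K.comp_closed)
      fix g' assume "g' \<in> Hom (comma C D F) r s"
      with g h show "cmp (comma C D F) h (add (comma C D F) g g') =
          add (comma C D F) (cmp (comma C D F) h g) (cmp (comma C D F) h g')"
        by (elim comma_HomE)
          (simp add: dom.in_Hom cod.in_Hom dom.comp_add_right cod.comp_add_right)
    qed
  qed
qed

text \<open>The componentwise inverse is an arrow of the comma category because conjugating the
  given square by \<open>a\<close> and \<open>b\<close> reverses it. The conclusion runs backwards
  since \<open>dense\<close> wants the image of the functor as the source.\<close>

lemma comma_isomorphicI:
  assumes h: "((X, Y, f), (X', Y', f'), (a, b)) \<in> Hom (comma C D F) (X, Y, f) (X', Y', f')"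
    and a: "is_iso C a" and b: "is_iso D b"
  shows "isomorphic (comma C D F) (X', Y', f') (X, Y, f)"
proof -
  interpret K: category "comma C D F" by (rule category_comma)
  have h': "(X, Y, f) \<in> obj (comma C D F)" "(X', Y', f') \<in> obj (comma C D F)"
    "a \<in> Hom C X X'" "b \<in> Hom D Y Y'" "f' \<cdot>\<^bsub>D\<^esub> amap F a = b \<cdot>\<^bsub>D\<^esub> f"
    using h by (simp_all add: Hom_def comma_arr_iff)
  have st: "a \<in> arr C" "src C a = X" "tgt C a = X'" "b \<in> arr D" "src D b = Y" "tgt D b = Y'"
    "f \<in> arr D" "src D f = omap F X" "tgt D f = Y" "f' \<in> arr D" "src D f' = omap F X'"
    "tgt D f' = Y'" and X: "X \<in> obj C" "X' \<in> obj C"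
    using h' by (simp_all add: comma_obj_iff dom.in_Hom cod.in_Hom)
  obtain c where c: "c \<in> arr C" "src C c = X'" "tgt C c = X"
    "c \<cdot>\<^bsub>C\<^esub> a = ident C X" "a \<cdot>\<^bsub>C\<^esub> c = ident C X'"
    using a by (rule dom.is_isoE) (simp add: st)
  obtain d where d: "d \<in> arr D" "src D d = Y'" "tgt D d = Y"
    "d \<cdot>\<^bsub>D\<^esub> b = ident D Y" "b \<cdot>\<^bsub>D\<^esub> d = ident D Y'"
    using b by (rule cod.is_isoE) (simp add: st)
  have "f \<cdot>\<^bsub>D\<^esub> amap F c = (d \<cdot>\<^bsub>D\<^esub> b) \<cdot>\<^bsub>D\<^esub> (f \<cdot>\<^bsub>D\<^esub> amap F c)"
    unfolding d(4) using st c by simp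
  also have "\<dots> = d \<cdot>\<^bsub>D\<^esub> ((b \<cdot>\<^bsub>D\<^esub> f) \<cdot>\<^bsub>D\<^esub> amap F c)"
    using st c d(1-3) by simp
  also have "\<dots> = d \<cdot>\<^bsub>D\<^esub> (f' \<cdot>\<^bsub>D\<^esub> amap F (a \<cdot>\<^bsub>C\<^esub> c))"
    unfolding h'(5)[symmetric] using st c(1-3) d by simp
  also have "\<dots> = d \<cdot>\<^bsub>D\<^esub> f'" unfolding c(5) using st X by simp
  finally have "((X', Y', f'), (X, Y, f), (c, d)) \<in> Hom (comma C D F) (X', Y', f') (X, Y, f)"
    by (intro comma_HomI) (use h' c d in \<open>simp_all add: dom.in_Hom cod.in_Hom\<close>)
  moreover from this have "is_iso (comma C D F) ((X', Y', f'), (X, Y, f), (c, d))"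
    by (intro K.is_iso_inverse(1)[OF _ h]) (simp_all add: c d)
  ultimately show ?thesis unfolding isomorphic_def by blast
qed

end

section \<open>Triangulated categories\<close>

lemma natural_isoD:
  assumes "natural_isomorphism C D F G \<alpha>"
  shows "natural_transformation C D F G \<alpha>" "X \<in> obj C \<Longrightarrow> is_iso D (\<alpha> X)"
  using assms by (simp_all add: natural_isomorphism_def)

context category
begin

lemma is_iso_left_cancel:
  assumes "is_iso C g" "g \<cdot> f = g \<cdot> f'" "f \<in> arr C" "f' \<in> arr C" "src C g = tgt C f" "src C g = tgt C f'"
  shows "f = f'"
proof -
  obtain k where k: "k \<in> arr C" "src C k = tgt C g" "tgt C k = src C g" "k \<cdot> g = ident C (src C g)"
    using assms(1) by (rule is_isoE)
  have g: "g \<in> arr C" using assms(1) by (rule is_iso_arr)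
  have "f = (k \<cdot> g) \<cdot> f" unfolding k(4) using assms by simp
  also have "\<dots> = k \<cdot> (g \<cdot> f)" using assms(3-) g k(1-3) by (intro comp_assoc') simp_all
  also have "\<dots> = (k \<cdot> g) \<cdot> f'"
    unfolding assms(2) using assms(3-) g k(1-3) by (intro comp_assoc'[symmetric]) simp_all
  also have "\<dots> = f'" unfolding k(4) using assms by simp
  finally show ?thesis .
qed

lemma is_iso_right_cancel:
  assumes "is_iso C g" "f \<cdot> g = f' \<cdot> g" "f \<in> arr C" "f' \<in> arr C" "src C f = tgt C g" "src C f' = tgt C g"
  shows "f = f'"
proof -
  obtain k where k: "k \<in> arr C" "src C k = tgt C g" "tgt C k = src C g" "g \<cdot> k = ident C (tgt C g)"
    using assms(1) by (rule is_isoE)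
  have g: "g \<in> arr C" using assms(1) by (rule is_iso_arr)
  have "f = f \<cdot> (g \<cdot> k)" unfolding k(4) using assms by simp
  also have "\<dots> = (f \<cdot> g) \<cdot> k" using assms(3-) g k(1-3) by (intro comp_assoc'[symmetric]) simp_all
  also have "\<dots> = f' \<cdot> (g \<cdot> k)"
    unfolding assms(2) using assms(3-) g k(1-3) by (intro comp_assoc') simp_all
  also have "\<dots> = f'" unfolding k(4) using assms by simp
  finally show ?thesis .
qed

text \<open>By naturality \<open>K f\<close> determines \<open>f\<close> up to an invertible
  component. The two natural isomorphisms of an equivalence point in opposite directions, hence a
  second version below.\<close>

lemma faithful_of_iso_from_id:
  assumes "natural_isomorphism C C id_functor K \<alpha>"
  shows "faithful C K"
  unfolding faithful_def
proof (intro ballI inj_onI)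
  interpret natural_transformation C C id_functor K \<alpha> using assms by (rule natural_isoD)
  fix X Y f g
  assume fg: "f \<in> Hom C X Y" "g \<in> Hom C X Y" "amap K f = amap K g"
  then have st: "f \<in> arr C" "src C f = X" "tgt C f = Y" "g \<in> arr C" "src C g = X" "tgt C g = Y"
    by (simp_all add: in_Hom)
  have Y: "Y \<in> obj C" using fg(1) by (simp add: Hom_obj)
  have "\<alpha> Y \<cdot> f = \<alpha> Y \<cdot> g"
    using naturality'[of f] naturality'[of g] st fg(3) by simp
  then show "f = g" using natural_isoD(2)[OF assms Y] st Y
    by (intro is_iso_left_cancel[of "\<alpha> Y" f g]) simp_all
qed

lemma faithful_of_iso_to_id:
  assumes "natural_isomorphism C C K id_functor \<alpha>"
  shows "faithful C K"
  unfolding faithful_def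
proof (intro ballI inj_onI)
  interpret natural_transformation C C K id_functor \<alpha> using assms by (rule natural_isoD)
  fix X Y f g
  assume X: "X \<in> obj C" and fg: "f \<in> Hom C X Y" "g \<in> Hom C X Y" "amap K f = amap K g"
  then have st: "f \<in> arr C" "src C f = X" "tgt C f = Y" "g \<in> arr C" "src C g = X" "tgt C g = Y"
    by (simp_all add: in_Hom)
  have "f \<cdot> \<alpha> X = \<alpha> Y \<cdot> amap K f" "g \<cdot> \<alpha> X = \<alpha> Y \<cdot> amap K g"
    using naturality'[of f] naturality'[of g] st by simp_all
  then have "f \<cdot> \<alpha> X = g \<cdot> \<alpha> X" using fg(3) by simp
  then show "f = g" using natural_isoD(2)[OF assms X] st X
    by (intro is_iso_right_cancel[of "\<alpha> X" f g]) simp_all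
qed

end

text \<open>For the suspension these three properties take the place of a strict inverse when arrows
  and objects are desuspended.\<close>

lemma equivalence_properties:
  fixes F :: "('o, 'm, 'p, 'n, 'w) functor_data_scheme"
  assumes "equivalence C D F"
  shows "faithful C F" "full C D F" "dense C D F"
proof -
  obtain G :: "('p, 'n, 'o, 'm) functor_data" and \<alpha> \<beta>
    where F: "is_functor C D F" and G: "is_functor D C G"
      and \<alpha>: "natural_isomorphism C C id_functor (G \<circ>\<^sub>F F) \<alpha>"
      and \<beta>: "natural_isomorphism D D (F \<circ>\<^sub>F G) id_functor \<beta>"
    using assms unfolding equivalence_def by blast
  interpret F: is_functor C D F by fact
  interpret G: is_functor D C G by fact
  interpret \<alpha>: natural_transformation C C id_functor "G \<circ>\<^sub>F F" \<alpha> using \<alpha> by (rule natural_isoD)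
  interpret \<beta>: natural_transformation D D "F \<circ>\<^sub>F G" id_functor \<beta> using \<beta> by (rule natural_isoD)
  have "faithful C (G \<circ>\<^sub>F F)" using \<alpha> by (rule F.dom.faithful_of_iso_from_id)
  then show "faithful C F" unfolding faithful_def inj_on_def by simp
  have FG: "faithful D (F \<circ>\<^sub>F G)" using \<beta> by (rule F.cod.faithful_of_iso_to_id)
  show "full C D F"
    unfolding full_def
  proof (intro ballI)
    fix X Y k assume X: "X \<in> obj C" and Y: "Y \<in> obj C" and k: "k \<in> Hom D (omap F X) (omap F Y)"
    have k': "k \<in> arr D" "src D k = omap F X" "tgt D k = omap F Y"
      using k by (simp_all add: F.cod.in_Hom)
    obtain \<alpha>' where \<alpha>': "\<alpha>' \<in> arr C" "src C \<alpha>' = omap G (omap F Y)" "tgt C \<alpha>' = Y"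
      "\<alpha> Y \<cdot>\<^bsub>C\<^esub> \<alpha>' = ident C (omap G (omap F Y))"
      using natural_isoD(2)[OF \<alpha> Y] by (rule F.dom.is_isoE) (use Y in simp)
    \<comment> \<open>Conjugating \<open>G k\<close> by the natural isomorphism \<alpha> gives the
      only possible preimage. Naturality yields \<open>G (F w) = G k\<close>, and faithfulness of
      \<open>F G\<close> removes \<open>G\<close>.\<close>
    define w where "w = \<alpha>' \<cdot>\<^bsub>C\<^esub> (amap G k \<cdot>\<^bsub>C\<^esub> \<alpha> X)"
    have w: "w \<in> arr C" "src C w = X" "tgt C w = Y"
      using \<alpha>'(1-3) k' X Y by (simp_all add: w_def)
    have "amap G (amap F w) \<cdot>\<^bsub>C\<^esub> \<alpha> X = \<alpha> Y \<cdot>\<^bsub>C\<^esub> w" using \<alpha>.naturality'[of w] w by simp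
    also have "\<dots> = ident C (omap G (omap F Y)) \<cdot>\<^bsub>C\<^esub> (amap G k \<cdot>\<^bsub>C\<^esub> \<alpha> X)"
      unfolding w_def using \<alpha>' k' X Y by (intro F.dom.comp_cong_right) simp_all
    also have "\<dots> = amap G k \<cdot>\<^bsub>C\<^esub> \<alpha> X" using k' X Y by simp
    finally have "amap G (amap F w) = amap G k"
      by (rule F.dom.is_iso_right_cancel[OF natural_isoD(2)[OF \<alpha> X]]) (use w k' X in simp_all)
    then have "amap (F \<circ>\<^sub>F G) (amap F w) = amap (F \<circ>\<^sub>F G) k" by simp
    moreover have "amap F w \<in> Hom D (omap F X) (omap F Y)"
      using w by (simp add: F.cod.in_Hom)
    ultimately have "amap F w = k"
      using FG k X Y F.omap_closed unfolding faithful_def by (meson inj_onD)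
    with w show "\<exists>f\<in>Hom C X Y. amap F f = k" by (intro bexI[of _ w]) (simp_all add: F.dom.in_Hom)
  qed
  show "dense C D F"
    unfolding dense_def isomorphic_def
  proof
    fix Y assume Y: "Y \<in> obj D"
    show "\<exists>X\<in>obj C. \<exists>f\<in>Hom D (omap F X) Y. is_iso D f"
      using natural_isoD(2)[OF \<beta> Y] \<beta>.component_closed[OF Y] Y
      by (intro bexI[of _ "omap G Y"] bexI[of _ "\<beta> Y"]) simp_all
  qed
qed

section \<open>Factorisations, isomorphism criteria and weak pushouts from exact triangles\<close>

context triangulated_category
begin

abbreviation \<Sigma> where "\<Sigma> \<equiv> amap (susp C)"
abbreviation \<Sigma>\<^sub>o where "\<Sigma>\<^sub>o \<equiv> omap (susp C)"

sublocale susp: additive_functor C C "susp C"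
  by (rule susp_additive)

lemmas susp_properties = equivalence_properties[OF susp_equivalence]

lemma susp_eqD:
  assumes "\<Sigma> f = \<Sigma> g" "f \<in> arr C" "g \<in> arr C" "src C g = src C f" "tgt C g = tgt C f"
  shows "f = g"
  using susp_properties(1)[unfolded faithful_def, rule_format, of "src C f" "tgt C f"] assms
  by (auto simp: inj_on_def in_Hom)

lemma susp_fullE:
  assumes "k \<in> arr C" "src C k = \<Sigma>\<^sub>o X" "tgt C k = \<Sigma>\<^sub>o Y" "X \<in> obj C" "Y \<in> obj C"
  obtains f where "f \<in> arr C" "src C f = X" "tgt C f = Y" "\<Sigma> f = k"
  using susp_properties(2)[unfolded full_def, rule_format, of X Y k] assms
  by (auto simp: in_Hom)

lemma exact_types:
  assumes "(f, g, h) \<in> exact C"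
  shows "f \<in> arr C" "g \<in> arr C" "h \<in> arr C"
    "src C g = tgt C f" "src C h = tgt C g" "tgt C h = \<Sigma>\<^sub>o (src C f)"
  using exact_is_triangle[OF assms] unfolding is_triangle_def in_Hom by auto

lemma rotate:
  assumes "(f, g, h) \<in> exact C"
  shows "(g, h, neg C (\<Sigma> f)) \<in> exact C"
  using exact_rotate[of "src C f" "tgt C f" "tgt C g" f g h] assms exact_types[OF assms]
  by (simp add: is_triangle_def in_Hom)

lemma rotate2:
  "(f, g, h) \<in> exact C \<Longrightarrow> (h, neg C (\<Sigma> f), neg C (\<Sigma> g)) \<in> exact C"
  by (intro rotate)

lemma morphism_completion:
  assumes "(f, g, h) \<in> exact C" "(f', g', h') \<in> exact C"
    "a \<in> arr C" "src C a = src C f" "tgt C a = src C f'"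
    "b \<in> arr C" "src C b = tgt C f" "tgt C b = tgt C f'" "b \<cdot> f = f' \<cdot> a"
  obtains c where "c \<in> arr C" "src C c = tgt C g" "tgt C c = tgt C g'"
    "c \<cdot> g = g' \<cdot> b" "\<Sigma> a \<cdot> h = h' \<cdot> c"
  using exact_morphism_completion[OF assms(1,2), of a b] exact_types[OF assms(1)]
    exact_types[OF assms(2)] assms
  by (auto simp: in_Hom triangle_morphism_def)

text \<open>Comparing with the triangle on an identity, whose third vertex is zero, makes
  \<open>g f\<close> factor through a zero object.\<close>

lemma exact_comp_zero:
  assumes "(f, g, h) \<in> exact C"
  shows "g \<cdot> f = zero C (src C f) (tgt C g)"
proof -
  note t = exact_types[OF assms]
  obtain Z where Z: "zero_object C Z" using zero_object_exists by blast
  have Z': "Z \<in> obj C" using Z by (rule zero_objectD)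
  have "(ident C (src C f), zero C (src C f) Z, zero C Z (\<Sigma>\<^sub>o (src C f))) \<in> exact C"
    using t Z by (intro exact_ident) simp_all
  then obtain c where c: "c \<in> arr C" "src C c = Z" "tgt C c = tgt C g"
    "c \<cdot> zero C (src C f) Z = g \<cdot> f"
    by (rule morphism_completion[OF _ assms, of _ _ _ "ident C (src C f)" f]) (use t Z' in simp_all)
  then show ?thesis using t Z' comp_zero_right[of c "src C f" Z] by simp
qed

lemma exact_zero_ident:
  assumes "W \<in> obj C" "zero_object C Z"
  shows "(zero C Z W, ident C W, zero C W (\<Sigma>\<^sub>o Z)) \<in> exact C"
proof -
  have Z: "Z \<in> obj C" using assms(2) by (rule zero_objectD)
  \<comment> \<open>The suspension of \<open>Z\<close> serves as the zero object, so that the last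
    arrow is the negated suspension of a zero arrow from \<open>Z\<close> to \<open>W\<close> and
    the triangle can be rotated backwards.\<close>
  have "(ident C W, zero C W (\<Sigma>\<^sub>o Z), neg C (\<Sigma> (zero C Z W))) \<in> exact C"
    using exact_ident[OF assms(1) susp.zero_object_omap[OF assms(2)]] assms(1) Z by simp
  then show ?thesis
    by (subst exact_rotate) (use assms Z in \<open>simp_all add: is_triangle_def in_Hom\<close>)
qed

text \<open>The weak cokernel property: \<open>u\<close> maps the given triangle to the one on
  \<open>0 \<rightarrow> W = W\<close>, and the third component is the factorisation.\<close>

lemma factor_through_second:
  assumes "(f, g, h) \<in> exact C" "u \<in> arr C" "src C u = tgt C f"
    "u \<cdot> f = zero C (src C f) (tgt C u)"
  obtains w where "w \<in> arr C" "src C w = tgt C g" "tgt C w = tgt C u" "w \<cdot> g = u"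
proof -
  note t = exact_types[OF assms(1)]
  obtain Z where Z: "zero_object C Z" using zero_object_exists by blast
  have Z': "Z \<in> obj C" using Z by (rule zero_objectD)
  obtain w where "w \<in> arr C" "src C w = tgt C g" "tgt C w = tgt C u"
    "w \<cdot> g = ident C (tgt C u) \<cdot> u"
    by (rule morphism_completion[OF assms(1) exact_zero_ident[OF _ Z, of "tgt C u"],
          of "zero C (src C f) Z" u])
      (use assms t Z' in simp_all)
  with that show ?thesis using assms by simp
qed

text \<open>The obstruction to extending \<open>v\<close> is \<open>\<Sigma> v \<cdot> h\<close>.
  When it vanishes, the weak cokernel property of the twice rotated triangle extends
  \<open>\<Sigma> v\<close>, and fullness desuspends the result.\<close>

lemma extend_along_first:
  assumes "(f, g, h) \<in> exact C" "v \<in> arr C" "src C v = src C f"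
    "\<Sigma> v \<cdot> h = zero C (src C h) (\<Sigma>\<^sub>o (tgt C v))"
  obtains w where "w \<in> arr C" "src C w = tgt C f" "tgt C w = tgt C v" "w \<cdot> f = v"
proof -
  note t = exact_types[OF assms(1)]
  obtain k where k: "k \<in> arr C" "src C k = \<Sigma>\<^sub>o (tgt C f)" "tgt C k = \<Sigma>\<^sub>o (tgt C v)"
    "k \<cdot> neg C (\<Sigma> f) = \<Sigma> v"
    by (rule factor_through_second[OF rotate2[OF assms(1)], of "\<Sigma> v"]) (use t assms in simp_all)
  obtain w where w: "w \<in> arr C" "src C w = tgt C f" "tgt C w = tgt C v" "\<Sigma> w = k"
    by (rule susp_fullE[OF k(1-3)]) (use t assms in simp_all)
  \<comment> \<open>The rotated triangle contains the negative of \<open>\<Sigma> f\<close>, so the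
    extension is the negative of the desuspended arrow.\<close>
  have "\<Sigma> (neg C w \<cdot> f) = \<Sigma> v" using w t k by simp
  then have "neg C w \<cdot> f = v" by (rule susp_eqD) (use w t assms in simp_all)
  with w that[of "neg C w"] show ?thesis by simp
qed

text \<open>As \<open>f = 0\<close>, the identity factors through \<open>g\<close>, which gives a
  left inverse \<open>w\<close>. The defect \<open>g w - 1\<close> vanishes on \<open>g\<close>, so
  it factors through \<open>h\<close>, whose target is the suspension of a zero object.\<close>

lemma is_iso_second:
  assumes "(f, g, h) \<in> exact C" "zero_object C (src C f)"
  shows "is_iso C g"
proof -
  note t = exact_types[OF assms(1)]
  have "ident C (tgt C f) \<cdot> f = zero C (src C f) (tgt C (ident C (tgt C f)))"
    using zero_objectD(2)[OF assms(2), of f] t by simp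
  note factor_through_second[OF assms(1) _ _ this]
  then obtain w where w: "w \<in> arr C" "src C w = tgt C g" "tgt C w = tgt C f"
    "w \<cdot> g = ident C (tgt C f)"
    using t by auto
  define d where "d = g \<cdot> w \<^bold>+ neg C (ident C (tgt C g))"
  have d: "d \<in> arr C" "src C d = tgt C g" "tgt C d = tgt C g" using t w by (simp_all add: d_def)
  have "d \<cdot> g = zero C (src C g) (tgt C d)"
    unfolding d using t w by (simp add: d_def comp_add_left)
  note factor_through_second[OF rotate[OF assms(1)] _ _ this]
  then obtain s where s: "s \<in> arr C" "src C s = \<Sigma>\<^sub>o (src C f)" "tgt C s = tgt C g" "s \<cdot> h = d"
    using t d by auto
  have "s = zero C (\<Sigma>\<^sub>o (src C f)) (tgt C g)"
    using zero_objectD(2)[OF susp.zero_object_omap[OF assms(2)], of s] s by simp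
  then have d0: "d = zero C (tgt C g) (tgt C g)" using s t by simp
  have "g \<cdot> w = ident C (tgt C g)"
    by (rule eq_iff_diff) (use t w d0 in \<open>simp_all add: d_def\<close>)
  with w t show ?thesis
    by (intro is_iso_inverse(2)[of w "tgt C g" "tgt C f"]) (simp_all add: in_Hom)
qed

text \<open>As \<open>h = 0\<close>, the identity extends along \<open>f\<close> to a left inverse
  \<open>w\<close>. The defect \<open>f w - 1\<close> vanishes on \<open>f\<close>, so it factors
  through \<open>g\<close>, whose target is zero.\<close>

lemma is_iso_first:
  assumes "(f, g, h) \<in> exact C" "zero_object C (tgt C g)"
  shows "is_iso C f"
proof -
  note t = exact_types[OF assms(1)]
  have "h = zero C (tgt C g) (\<Sigma>\<^sub>o (src C f))"
    using zero_objectD(2)[OF assms(2), of h] t by simp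
  then have "\<Sigma> (ident C (src C f)) \<cdot> h = zero C (src C h) (\<Sigma>\<^sub>o (tgt C (ident C (src C f))))"
    using t by simp
  note extend_along_first[OF assms(1) _ _ this]
  then obtain w where w: "w \<in> arr C" "src C w = tgt C f" "tgt C w = src C f"
    "w \<cdot> f = ident C (src C f)"
    using t by auto
  define d where "d = f \<cdot> w \<^bold>+ neg C (ident C (tgt C f))"
  have d: "d \<in> arr C" "src C d = tgt C f" "tgt C d = tgt C f" using t w by (simp_all add: d_def)
  have "d \<cdot> f = zero C (src C f) (tgt C d)"
    unfolding d using t w by (simp add: d_def comp_add_left)
  note factor_through_second[OF assms(1) _ _ this]
  then obtain s where s: "s \<in> arr C" "src C s = tgt C g" "tgt C s = tgt C f" "s \<cdot> g = d"
    using t d by auto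
  have "s = zero C (tgt C g) (tgt C f)"
    using zero_objectD(2)[OF assms(2), of s] s by simp
  then have d0: "d = zero C (tgt C f) (tgt C f)" using s t by simp
  have "f \<cdot> w = ident C (tgt C f)"
    by (rule eq_iff_diff) (use t w d0 in \<open>simp_all add: d_def\<close>)
  with w t show ?thesis
    by (intro is_iso_inverse(2)[of w "tgt C f" "src C f"]) (simp_all add: in_Hom)
qed

text \<open>First extend \<open>v\<close> along \<open>f'\<close>; the defect on \<open>b\<close> factors through \<open>g\<close>, and, as \<open>c\<close> is
  invertible, it can be corrected by a map that factors through \<open>g'\<close>.\<close>

lemma weak_pushout:
  assumes ex: "(f, g, h) \<in> exact C" "(f', g', h') \<in> exact C"
    and a: "a \<in> arr C" "src C a = src C f" "tgt C a = src C f'"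
    and b: "b \<in> arr C" "src C b = tgt C f" "tgt C b = tgt C f'"
    and c: "c \<in> arr C" "src C c = tgt C g" "tgt C c = tgt C g'" "is_iso C c"
    and cg: "c \<cdot> g = g' \<cdot> b" and ah: "\<Sigma> a \<cdot> h = h' \<cdot> c"
    and u: "u \<in> arr C" "src C u = tgt C f" and v: "v \<in> arr C" "src C v = src C f'"
    and uv: "tgt C v = tgt C u" "u \<cdot> f = v \<cdot> a"
    and bf: "b \<cdot> f = f' \<cdot> a"
  obtains w where "w \<in> arr C" "src C w = tgt C f'" "tgt C w = tgt C u" "w \<cdot> b = u" "w \<cdot> f' = v"
proof -
  note t = exact_types[OF ex(1)] and t' = exact_types[OF ex(2)]
  obtain d where d: "d \<in> arr C" "src C d = tgt C g'" "tgt C d = tgt C g"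
    "d \<cdot> c = ident C (tgt C g)"
    using c(4) by (rule is_isoE) (use c in simp)
  \<comment> \<open>The obstruction to extending \<open>v\<close> along \<open>f'\<close> may be
    tested after the isomorphism \<open>c\<close>; there it becomes
    \<open>\<Sigma> (u f) \<cdot> h\<close>, and \<open>\<Sigma> f \<cdot> h = 0\<close>.\<close>
  have "\<Sigma> v \<cdot> (h' \<cdot> c) = \<Sigma> (v \<cdot> a) \<cdot> h"
    unfolding ah[symmetric] using v a t by simp
  also have "\<dots> = \<Sigma> u \<cdot> (\<Sigma> f \<cdot> h)" unfolding uv(2)[symmetric] using u t by simp
  also have "\<Sigma> f \<cdot> h = zero C (src C h) (\<Sigma>\<^sub>o (tgt C f))"
  proof -
    have "neg C (\<Sigma> f \<cdot> h) = zero C (src C h) (\<Sigma>\<^sub>o (tgt C f))"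
      using exact_comp_zero[OF rotate2[OF ex(1)]] t by simp
    then have "neg C (neg C (\<Sigma> f \<cdot> h)) = neg C (zero C (src C h) (\<Sigma>\<^sub>o (tgt C f)))"
      by simp
    then show ?thesis using t by simp
  qed
  finally have "(\<Sigma> v \<cdot> h') \<cdot> c = zero C (src C h') (\<Sigma>\<^sub>o (tgt C v)) \<cdot> c"
    using u v uv c t t' by simp
  then have vh: "\<Sigma> v \<cdot> h' = zero C (src C h') (\<Sigma>\<^sub>o (tgt C v))"
    by (rule is_iso_right_cancel[OF c(4)]) (use u v uv c t t' in simp_all)
  obtain w where w: "w \<in> arr C" "src C w = tgt C f'" "tgt C w = tgt C v" "w \<cdot> f' = v"
    by (rule extend_along_first[OF ex(2) v vh])
  define e where "e = u \<^bold>+ neg C (w \<cdot> b)"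
  have e: "e \<in> arr C" "src C e = tgt C f" "tgt C e = tgt C u"
    using u w b uv by (simp_all add: e_def)
  have "(w \<cdot> b) \<cdot> f = v \<cdot> a"
    using w b t t' a bf comp_cong_right[OF w(4), of a] by simp
  then have "e \<cdot> f = zero C (src C f) (tgt C e)"
    unfolding e using u w b t a v uv by (simp add: e_def comp_add_left)
  from factor_through_second[OF ex(1) e(1,2) this]
  obtain s where s: "s \<in> arr C" "src C s = tgt C g" "tgt C s = tgt C u" "s \<cdot> g = e"
    using e by auto
  \<comment> \<open>Since \<open>d g' b = d c g = g\<close>, the correction \<open>s d g'\<close>
    repairs the value on \<open>b\<close>; since \<open>g' f' = 0\<close>, it leaves the value on
    \<open>f'\<close> unchanged.\<close>
  have "(s \<cdot> d \<cdot> g') \<cdot> b = e"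
  proof -
    have "(s \<cdot> d \<cdot> g') \<cdot> b = s \<cdot> (d \<cdot> (c \<cdot> g))"
      unfolding cg using s d t' b by simp
    also have "\<dots> = s \<cdot> ((d \<cdot> c) \<cdot> g)" using s d(1-3) t c by simp
    also have "\<dots> = e" unfolding d(4) using s t by simp
    finally show ?thesis .
  qed
  moreover have "(s \<cdot> d \<cdot> g') \<cdot> f' = zero C (src C f') (tgt C u)"
    using exact_comp_zero[OF ex(2)] s d t' by simp
  ultimately show ?thesis
    using that[of "w \<^bold>+ s \<cdot> d \<cdot> g'"] s d w t' b u uv v
      add_neg_cancel[of u "w \<cdot> b"]
    by (simp add: comp_add_left e_def)
qed

text \<open>The axioms complete a first arrow only. So \<open>h\<close> is completed as a first
  arrow, the new vertex is replaced by an isomorphic suspension, and the triangle is rotated back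
  twice.\<close>

lemma exact_cocone:
  assumes h: "h \<in> arr C" "tgt C h = \<Sigma>\<^sub>o A" "A \<in> obj C"
  obtains f g where "(f, g, h) \<in> exact C" "src C f = A"
proof -
  obtain p q where pq: "(h, p, q) \<in> exact C" using exact_completion[OF h(1)] by blast
  note t = exact_types[OF pq]
  obtain B e where B: "B \<in> obj C" and e: "e \<in> arr C" "src C e = \<Sigma>\<^sub>o B" "tgt C e = tgt C p"
    "is_iso C e"
    using susp_properties(3)[unfolded dense_def isomorphic_def, rule_format, of "tgt C p"] t
    by (auto simp: in_Hom)
  obtain d where d: "d \<in> arr C" "src C d = tgt C p" "tgt C d = \<Sigma>\<^sub>o B"
    "d \<cdot> e = ident C (\<Sigma>\<^sub>o B)" "e \<cdot> d = ident C (tgt C p)"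
    using e(4) by (rule is_isoE) (use e in simp)
  have diso: "is_iso C d"
    by (rule is_iso_inverse(1)[of d "tgt C p" "\<Sigma>\<^sub>o B" e]) (use d e in \<open>simp_all add: in_Hom\<close>)
  have "q = (q \<cdot> e) \<cdot> d" using t e d by simp
  then have "(h, d \<cdot> p, q \<cdot> e) \<in> exact C"
    using t e(1-3) d(1-3) h diso
    by (intro exact_iso_closed[OF pq, of "src C h" "\<Sigma>\<^sub>o A" "\<Sigma>\<^sub>o B" _ _ _
          "ident C (src C h)" "ident C (\<Sigma>\<^sub>o A)" d])
      (simp_all add: is_triangle_def triangle_morphism_def in_Hom is_iso_ident)
  moreover obtain f where f: "f \<in> arr C" "src C f = A" "tgt C f = B" "\<Sigma> f = d \<cdot> p"
    by (rule susp_fullE[of "d \<cdot> p" A B]) (use d t h B in simp_all)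
  moreover obtain g where g: "g \<in> arr C" "src C g = B" "tgt C g = src C h" "\<Sigma> g = q \<cdot> e"
    by (rule susp_fullE[of "q \<cdot> e" B "src C h"]) (use e t h B in simp_all)
  \<comment> \<open>Double negation puts the last two arrows into the shape that
    \<open>exact_rotate\<close> produces, so it can be read from right to left.\<close>
  ultimately have "(h, neg C (\<Sigma> (neg C f)), neg C (\<Sigma> (neg C g))) \<in> exact C"
    using t d(1-3) e(1-3) by simp
  then have "(neg C g, h, neg C (\<Sigma> (neg C f))) \<in> exact C"
    using f(1-3) g(1-3) h
    by (subst exact_rotate[of B "src C h" "\<Sigma>\<^sub>o A"]) (simp_all add: is_triangle_def in_Hom)
  then have "(neg C f, neg C g, h) \<in> exact C"
    using f(1-3) g(1-3) h
    by (subst exact_rotate[of A B "src C h"]) (simp_all add: is_triangle_def in_Hom)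
  then show ?thesis using that f by simp
qed

text \<open>Rotating both triangles twice moves the middle vertex into third position, where the
  axiom provides the fill-in. Desuspending uses fullness for the arrow and faithfulness for its
  equations, in which the signs cancel.\<close>

lemma morphism_completion_middle:
  assumes ex: "(f, g, h) \<in> exact C" "(f', g', h') \<in> exact C"
    and a: "a \<in> arr C" "src C a = src C f" "tgt C a = src C f'"
    and c: "c \<in> arr C" "src C c = tgt C g" "tgt C c = tgt C g'"
    and ah: "\<Sigma> a \<cdot> h = h' \<cdot> c"
  obtains b where "b \<in> arr C" "src C b = tgt C f" "tgt C b = tgt C f'"
    "b \<cdot> f = f' \<cdot> a" "g' \<cdot> b = c \<cdot> g"
proof -
  note t = exact_types[OF ex(1)] and t' = exact_types[OF ex(2)]
  obtain k where k: "k \<in> arr C" "src C k = \<Sigma>\<^sub>o (tgt C f)" "tgt C k = \<Sigma>\<^sub>o (tgt C f')"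
    "k \<cdot> neg C (\<Sigma> f) = neg C (\<Sigma> f') \<cdot> \<Sigma> a" "\<Sigma> c \<cdot> neg C (\<Sigma> g) = neg C (\<Sigma> g') \<cdot> k"
    by (rule morphism_completion[OF rotate2[OF ex(1)] rotate2[OF ex(2)], of c "\<Sigma> a"])
      (use t t' a c ah in simp_all)
  obtain b where b: "b \<in> arr C" "src C b = tgt C f" "tgt C b = tgt C f'" "\<Sigma> b = k"
    by (rule susp_fullE[OF k(1-3)]) (use t t' in simp_all)
  have n: "neg C (\<Sigma> (b \<cdot> f)) = neg C (\<Sigma> (f' \<cdot> a))" "neg C (\<Sigma> (g' \<cdot> b)) = neg C (\<Sigma> (c \<cdot> g))"
    using k b t t' a c by simp_all
  have "\<Sigma> (b \<cdot> f) = \<Sigma> (f' \<cdot> a)"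
    by (rule neg_eq_iff[THEN iffD1, OF _ _ n(1)]) (use k(1-3) b t t' a in simp_all)
  then have "b \<cdot> f = f' \<cdot> a" by (rule susp_eqD) (use k(1-3) b t t' a in simp_all)
  moreover have "\<Sigma> (g' \<cdot> b) = \<Sigma> (c \<cdot> g)"
    by (rule neg_eq_iff[THEN iffD1, OF _ _ n(2)]) (use k(1-3) b t t' c in simp_all)
  then have "g' \<cdot> b = c \<cdot> g" by (rule susp_eqD) (use k(1-3) b t t' c in simp_all)
  ultimately show ?thesis using that b by simp
qed

end

section \<open>Recollements\<close>

text \<open>The image triangle is exact with zero first vertex. It is applied to \<open>j\<close>,
  which kills the image of \<open>i\<close>; the companion below is applied to \<open>ir\<close>,
  which kills the image of \<open>jr\<close>.\<close>

lemma (in triangle_functor) is_iso_amap_second: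
  assumes "(f, g, h) \<in> exact C" "zero_object D (omap F (src C f))"
  shows "is_iso D (amap F g)"
  using cod.is_iso_second[OF amap_exact[OF assms(1)]] assms(2) dom.exact_types(1)[OF assms(1)]
  by simp

lemma (in triangle_functor) is_iso_amap_first:
  assumes "(f, g, h) \<in> exact C" "zero_object D (omap F (tgt C g))"
  shows "is_iso D (amap F f)"
  using cod.is_iso_first[OF amap_exact[OF assms(1)]] assms(2) dom.exact_types(2)[OF assms(1)]
  by simp

lemma additive_functor_comp:
  assumes "additive_functor C D F" "additive_functor D E G"
  shows "additive_functor C E (G \<circ>\<^sub>F F)"
proof -
  interpret F: additive_functor C D F by fact
  interpret G: additive_functor D E G by fact
  show ?thesis
    by unfold_locales
      (auto simp: F.dom.in_Hom F.cod.in_Hom G.cod.in_Hom hom_def hom_group_def F.amap_add G.amap_add)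
qed

context recollement
begin

text \<open>By a triangle identity this arrow is a one-sided inverse of the unit of
  \<open>(jl, j)\<close>, which is invertible because \<open>jl\<close> is fully faithful.\<close>

lemma is_iso_j_phi:
  assumes "X \<in> obj T"
  shows "is_iso T'' (amap j (\<phi> X))"
  by (rule j.cod.is_iso_cancel_right[of "amap j (\<phi> X)" "\<kappa>jl (omap j X)"])
    (use assms jl_j.triangle_right[OF assms] jl_j.is_iso_unit[OF jl_full jl_faithful]
      in \<open>simp_all add: j.cod.is_iso_ident\<close>)

lemma lift_arrow:
  assumes X: "X \<in> obj T" and Y: "Y \<in> obj T"
    and a: "a \<in> arr T''" "src T'' a = omap j X" "tgt T'' a = omap j Y"
    and b: "b \<in> arr T'" "src T' b = omap ir X" "tgt T' b = omap ir Y"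
    and sq: "amap ir (\<phi> Y) \<cdot>\<^bsub>T'\<^esub> amap ir (amap jl a) = b \<cdot>\<^bsub>T'\<^esub> amap ir (\<phi> X)"
  obtains f where "f \<in> Hom T X Y" "amap j f = a" "amap ir f = b"
proof -
  define B where "B = omap jl (omap j X)"
  have B: "B \<in> obj T" using X by (simp add: B_def)
  have \<phi>X: "\<phi> X \<in> arr T" "src T (\<phi> X) = B" "tgt T (\<phi> X) = X" using X by (simp_all add: B_def)
  have \<phi>Y: "\<phi> Y \<in> arr T" "src T (\<phi> Y) = omap jl (omap j Y)" "tgt T (\<phi> Y) = Y" using Y by simp_all
  obtain \<delta> where \<delta>: "(\<epsilon> B, \<eta> B, \<delta>) \<in> exact T" using triangle_i_ir[OF B] by blast
  obtain \<delta>' where \<delta>': "(\<epsilon> X, \<eta> X, \<delta>') \<in> exact T" using triangle_i_ir[OF X] by blast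
  have nat\<epsilon>: "\<phi> X \<cdot>\<^bsub>T\<^esub> \<epsilon> B = \<epsilon> X \<cdot>\<^bsub>T\<^esub> amap i (amap ir (\<phi> X))"
    using i_ir.counit.naturality'[of "\<phi> X"] \<phi>X by simp
  obtain c where c: "c \<in> arr T" "src T c = omap jr (omap j B)" "tgt T c = omap jr (omap j X)"
    "c \<cdot>\<^bsub>T\<^esub> \<eta> B = \<eta> X \<cdot>\<^bsub>T\<^esub> \<phi> X"
    "amap (susp T) (amap i (amap ir (\<phi> X))) \<cdot>\<^bsub>T\<^esub> \<delta> = \<delta>' \<cdot>\<^bsub>T\<^esub> c"
    by (rule i.cod.morphism_completion[OF \<delta> \<delta>', of "amap i (amap ir (\<phi> X))" "\<phi> X"])
      (use X B \<phi>X nat\<epsilon> in simp_all)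
  obtain k where k: "k \<in> Hom T'' (omap j B) (omap j X)" "amap jr k = c"
    using jr_full[unfolded full_def, rule_format, of "omap j B" "omap j X" c] c X B
    by (auto simp: i.cod.in_Hom)
  then have k': "k \<in> arr T''" "src T'' k = omap j B" "tgt T'' k = omap j X"
    by (simp_all add: j.cod.in_Hom)
  \<comment> \<open>Transposing \<open>c \<cdot> \<eta> B = \<eta> X \<cdot> \<phi> X\<close> along
    \<open>(j, jr)\<close> identifies \<open>k\<close> with \<open>j (\<phi> X)\<close>, so the
    arbitrary fill-in \<open>c\<close> turns out to be invertible.\<close>
  have "k = (k \<cdot>\<^bsub>T''\<^esub> \<kappa>j (omap j B)) \<cdot>\<^bsub>T''\<^esub> amap j (\<eta> B)"
    using k' B j_jr.triangle_left[OF B] by simp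
  also have "k \<cdot>\<^bsub>T''\<^esub> \<kappa>j (omap j B) = \<kappa>j (omap j X) \<cdot>\<^bsub>T''\<^esub> amap j c"
    using j_jr.counit.naturality'[of k] k' k(2) by simp
  also have "(\<kappa>j (omap j X) \<cdot>\<^bsub>T''\<^esub> amap j c) \<cdot>\<^bsub>T''\<^esub> amap j (\<eta> B)
      = \<kappa>j (omap j X) \<cdot>\<^bsub>T''\<^esub> amap j (c \<cdot>\<^bsub>T\<^esub> \<eta> B)"
    using c(1-3) X B by simp
  also have "\<dots> = \<kappa>j (omap j X) \<cdot>\<^bsub>T''\<^esub> (amap j (\<eta> X) \<cdot>\<^bsub>T''\<^esub> amap j (\<phi> X))"
    unfolding c(4) using X \<phi>X by simp
  also have "\<dots> = amap j (\<phi> X)"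
    using j.cod.comp_cong_right[OF j_jr.triangle_left[OF X], of "amap j (\<phi> X)"] X \<phi>X by simp
  finally have "is_iso T c"
    using jr.is_iso_amap[OF is_iso_j_phi[OF X]] k(2) by simp
  \<comment> \<open>\<open>u\<close> is the transpose of \<open>a\<close> along
    \<open>(jl, j)\<close> and \<open>v\<close> that of \<open>b\<close> along
    \<open>(i, ir)\<close>; naturality of \<epsilon> translates \<open>sq\<close> into their
    agreement on \<open>i ir B\<close>.\<close>
  define u where "u = \<phi> Y \<cdot>\<^bsub>T\<^esub> amap jl a"
  define v where "v = \<epsilon> Y \<cdot>\<^bsub>T\<^esub> amap i b"
  have u: "u \<in> arr T" "src T u = B" "tgt T u = Y" and v: "v \<in> arr T" "src T v = omap i (omap ir X)" "tgt T v = Y"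
    using a b \<phi>Y Y by (simp_all add: u_def v_def B_def)
  have "u \<cdot>\<^bsub>T\<^esub> \<epsilon> B = \<phi> Y \<cdot>\<^bsub>T\<^esub> (\<epsilon> (omap jl (omap j Y)) \<cdot>\<^bsub>T\<^esub> amap i (amap ir (amap jl a)))"
    using i_ir.counit.naturality'[of "amap jl a"] a \<phi>Y B X Y by (simp add: u_def B_def)
  also have "\<dots> = (\<epsilon> Y \<cdot>\<^bsub>T\<^esub> amap i (amap ir (\<phi> Y))) \<cdot>\<^bsub>T\<^esub> amap i (amap ir (amap jl a))"
    by (rule i.cod.comp_cong_right) (use i_ir.counit.naturality'[of "\<phi> Y"] \<phi>Y a Y in simp_all)
  also have "\<dots> = \<epsilon> Y \<cdot>\<^bsub>T\<^esub> amap i (amap ir (\<phi> Y) \<cdot>\<^bsub>T'\<^esub> amap ir (amap jl a))"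
    using \<phi>Y a Y by simp
  also have "\<dots> = v \<cdot>\<^bsub>T\<^esub> amap i (amap ir (\<phi> X))"
    unfolding sq v_def using b X Y \<phi>X by simp
  finally have uv: "u \<cdot>\<^bsub>T\<^esub> \<epsilon> B = v \<cdot>\<^bsub>T\<^esub> amap i (amap ir (\<phi> X))" .
  obtain w where w: "w \<in> arr T" "src T w = X" "tgt T w = Y" "w \<cdot>\<^bsub>T\<^esub> \<phi> X = u" "w \<cdot>\<^bsub>T\<^esub> \<epsilon> X = v"
    by (rule i.cod.weak_pushout[OF \<delta> \<delta>' _ _ _ \<phi>X(1) _ _ c(1) _ _ \<open>is_iso T c\<close> c(4,5)
          u(1) _ v(1) _ _ uv nat\<epsilon>])
      (use X B \<phi>X c(2,3) u(2,3) v(2,3) in simp_all)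
  \<comment> \<open>Transposing back: \<open>w \<cdot> \<phi> X = u\<close> determines
    \<open>j w\<close>, and below \<open>w \<cdot> \<epsilon> X = v\<close> determines
    \<open>ir w\<close>.\<close>
  have "amap j w = amap j w \<cdot>\<^bsub>T''\<^esub> (amap j (\<phi> X) \<cdot>\<^bsub>T''\<^esub> \<kappa>jl (omap j X))"
    using jl_j.triangle_right[OF X] w X by simp
  also have "\<dots> = amap j (w \<cdot>\<^bsub>T\<^esub> \<phi> X) \<cdot>\<^bsub>T''\<^esub> \<kappa>jl (omap j X)"
    using w(1-3) \<phi>X X by (simp add: B_def)
  also have "\<dots> = amap j (\<phi> Y) \<cdot>\<^bsub>T''\<^esub> (\<kappa>jl (omap j Y) \<cdot>\<^bsub>T''\<^esub> a)"
    unfolding w(4) u_def using jl_j.unit.naturality'[of a] \<phi>Y a X Y by simp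
  also have "\<dots> = a"
    using j.cod.comp_cong_right[OF jl_j.triangle_right[OF Y], of a] a Y by simp
  finally have jw: "amap j w = a" .
  have "amap ir w = amap ir w \<cdot>\<^bsub>T'\<^esub> (amap ir (\<epsilon> X) \<cdot>\<^bsub>T'\<^esub> \<kappa>i (omap ir X))"
    using i_ir.triangle_right[OF X] w X by simp
  also have "\<dots> = amap ir (w \<cdot>\<^bsub>T\<^esub> \<epsilon> X) \<cdot>\<^bsub>T'\<^esub> \<kappa>i (omap ir X)"
    using w(1-3) X by simp
  also have "\<dots> = amap ir (\<epsilon> Y) \<cdot>\<^bsub>T'\<^esub> (\<kappa>i (omap ir Y) \<cdot>\<^bsub>T'\<^esub> b)"
    unfolding w(5) v_def using i_ir.unit.naturality'[of b] b X Y by simp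
  also have "\<dots> = b"
    using i.dom.comp_cong_right[OF i_ir.triangle_right[OF Y], of b] b Y by simp
  finally have irw: "amap ir w = b" .
  show ?thesis using that[of w] w(1-3) jw irw by (simp add: i.cod.in_Hom)
qed

text \<open>Arrows from \<open>i N\<close> to \<open>jr P\<close> correspond to arrows from
  \<open>j i N = 0\<close> to \<open>P\<close>, so they vanish. For the counit \<epsilon> at
  \<open>jr P\<close> this makes the identity of \<open>ir jr P\<close> zero by a triangle
  identity.\<close>

lemma zero_object_ir_jr:
  assumes P: "P \<in> obj T''"
  shows "zero_object T' (omap ir (omap jr P))"
proof (rule i.dom.zero_objectI)
  define R where "R = omap jr P"
  have R: "R \<in> obj T" using P by (simp add: R_def)
  define N where "N = omap ir R"
  have N: "N \<in> obj T'" using R by (simp add: N_def)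
  show "omap ir (omap jr P) \<in> obj T'" using P by simp
  have \<epsilon>: "\<epsilon> R \<in> arr T" "src T (\<epsilon> R) = omap i N" "tgt T (\<epsilon> R) = R"
    using R by (simp_all add: N_def)
  have "\<epsilon> R = (amap jr (\<kappa>j P) \<cdot>\<^bsub>T\<^esub> \<eta> R) \<cdot>\<^bsub>T\<^esub> \<epsilon> R"
    using j_jr.triangle_right[OF P] \<epsilon> R by (simp add: R_def)
  also have "\<dots> = amap jr (\<kappa>j P) \<cdot>\<^bsub>T\<^esub> (amap jr (amap j (\<epsilon> R)) \<cdot>\<^bsub>T\<^esub> \<eta> (omap i N))"
    using j_jr.unit.naturality'[of "\<epsilon> R"] \<epsilon> R P by (simp add: R_def)
  also have "amap j (\<epsilon> R) = zero T'' (omap j (omap i N)) (omap j R)"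
    using j.cod.zero_objectD(2)[OF j_i_zero[OF N], of "amap j (\<epsilon> R)"] \<epsilon> by simp
  also have "amap jr (\<kappa>j P) \<cdot>\<^bsub>T\<^esub>
      (amap jr (zero T'' (omap j (omap i N)) (omap j R)) \<cdot>\<^bsub>T\<^esub> \<eta> (omap i N)) = zero T (omap i N) R"
    using P R N by (simp add: R_def)
  finally have "\<epsilon> R = zero T (omap i N) R" .
  then show "ident T' (omap ir (omap jr P)) = zero T' (omap ir (omap jr P)) (omap ir (omap jr P))"
    using i_ir.triangle_right[OF R] R N by (simp add: R_def[symmetric] N_def[symmetric])
qed

text \<open>\<open>X\<close> is the homotopy pushout of \<open>i f\<close> and the counit \<open>\<epsilon>\<close> at \<open>jl M\<close>, constructed as the cocone of
  the connecting morphism of \<open>\<epsilon>\<close> followed by the suspension of \<open>i f\<close>.\<close>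

lemma realize_object:
  assumes M: "M \<in> obj T''" and N: "N \<in> obj T'"
    and f: "f \<in> arr T'" "src T' f = omap ir (omap jl M)" "tgt T' f = N"
  obtains X a b where "X \<in> obj T" "a \<in> Hom T'' M (omap j X)" "b \<in> Hom T' N (omap ir X)"
    "is_iso T'' a" "is_iso T' b" "amap ir (\<phi> X) \<cdot>\<^bsub>T'\<^esub> amap ir (amap jl a) = b \<cdot>\<^bsub>T'\<^esub> f"
proof -
  define L where "L = omap jl M"
  have L: "L \<in> obj T" using M by (simp add: L_def)
  have f': "src T' f = omap ir L" using f by (simp add: L_def)
  obtain \<delta> where \<delta>: "(\<epsilon> L, \<eta> L, \<delta>) \<in> exact T" using triangle_i_ir[OF L] by blast
  note \<delta>t = i.cod.exact_types[OF \<delta>]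
  have \<epsilon>: "\<epsilon> L \<in> arr T" "src T (\<epsilon> L) = omap i (omap ir L)" "tgt T (\<epsilon> L) = L"
    and \<eta>: "\<eta> L \<in> arr T" "src T (\<eta> L) = L" "tgt T (\<eta> L) = omap jr (omap j L)"
    using L by simp_all
  define h where "h = amap (susp T) (amap i f) \<cdot>\<^bsub>T\<^esub> \<delta>"
  have h: "h \<in> arr T" "src T h = omap jr (omap j L)" "tgt T h = omap (susp T) (omap i N)"
    using f f' \<delta>t \<epsilon> \<eta> by (simp_all add: h_def)
  obtain u v where uv: "(u, v, h) \<in> exact T" "src T u = omap i N"
    by (rule i.cod.exact_cocone[OF h(1,3)]) (use N in simp_all)
  note uvt = i.cod.exact_types[OF uv(1)]
  define X where "X = tgt T u"
  have X: "X \<in> obj T" using uvt by (simp add: X_def)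
  have u: "u \<in> arr T" "src T u = omap i N" "tgt T u = X"
    and v: "v \<in> arr T" "src T v = X" "tgt T v = omap jr (omap j L)"
    using uv uvt h by (simp_all add: X_def)
  \<comment> \<open>Both triangles end in \<open>jr j L\<close>, and \<open>h\<close> is defined so
    that \<open>i f\<close> and the identity of that vertex are compatible; \<open>b\<close> is the
    leg of the pushout starting at \<open>L\<close>.\<close>
  obtain b where b: "b \<in> arr T" "src T b = L" "tgt T b = X" "b \<cdot>\<^bsub>T\<^esub> \<epsilon> L = u \<cdot>\<^bsub>T\<^esub> amap i f"
    "v \<cdot>\<^bsub>T\<^esub> b = ident T (omap jr (omap j L)) \<cdot>\<^bsub>T\<^esub> \<eta> L"
    by (rule i.cod.morphism_completion_middle[OF \<delta> uv(1), of "amap i f" "ident T (omap jr (omap j L))"])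
      (use u v h \<delta>t \<epsilon> \<eta> f f' L in \<open>simp_all add: h_def\<close>)
  \<comment> \<open>Both \<open>v\<close> and \<open>\<eta> L\<close> have a fibre in the image of
    \<open>i\<close>, so \<open>j\<close> inverts them; then \<open>v b = \<eta> L\<close> makes
    \<open>j b\<close> invertible as well.\<close>
  have jv: "is_iso T'' (amap j v)"
    by (rule j.is_iso_amap_second[OF uv(1)]) (use u N j_i_zero in simp)
  have j\<eta>: "is_iso T'' (amap j (\<eta> L))"
    by (rule j.is_iso_amap_second[OF \<delta>]) (use \<epsilon> L j_i_zero in simp)
  have "amap j v \<cdot>\<^bsub>T''\<^esub> amap j b = amap j (v \<cdot>\<^bsub>T\<^esub> b)" using v b(1-3) by simp
  also have "\<dots> = amap j (\<eta> L)" unfolding b(5) using \<eta> by simp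
  finally have jb: "is_iso T'' (amap j b)"
    using jv j\<eta> v b(1-3) by (intro j.cod.is_iso_cancel_left[of "amap j v" "amap j b"]) simp_all
  define p where "p = amap j b \<cdot>\<^bsub>T''\<^esub> \<kappa>jl M"
  have p: "p \<in> arr T''" "src T'' p = M" "tgt T'' p = omap j X"
    using b(1-3) M by (simp_all add: p_def L_def)
  have p_iso: "is_iso T'' p"
    unfolding p_def using jb jl_j.is_iso_unit[OF jl_full jl_faithful M] b(1-3) M
    by (intro j.cod.is_iso_comp) (simp_all add: L_def)
  \<comment> \<open>The cone of \<open>u\<close> lies in the image of \<open>jr\<close>, which
    \<open>ir\<close> kills.\<close>
  have ir_u: "is_iso T' (amap ir u)"
    by (rule ir.is_iso_amap_first[OF uv(1)]) (use v L zero_object_ir_jr in simp)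
  define q where "q = amap ir u \<cdot>\<^bsub>T'\<^esub> \<kappa>i N"
  have q: "q \<in> arr T'" "src T' q = N" "tgt T' q = omap ir X"
    using u N by (simp_all add: q_def)
  have q_iso: "is_iso T' q"
    unfolding q_def using ir_u i_ir.is_iso_unit[OF i_full i_faithful N] u N
    by (intro i.dom.is_iso_comp) simp_all
  \<comment> \<open>\<open>p\<close> is the transpose of \<open>b\<close>, so this composite returns
    \<open>b\<close>; applying \<open>ir\<close> to
    \<open>b \<cdot> \<epsilon> L = u \<cdot> i f\<close> then gives the required square.\<close>
  have "\<phi> X \<cdot>\<^bsub>T\<^esub> amap jl p = (\<phi> X \<cdot>\<^bsub>T\<^esub> amap jl (amap j b)) \<cdot>\<^bsub>T\<^esub> amap jl (\<kappa>jl M)"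
    using b(1-3) M X by (simp add: p_def L_def)
  also have "\<dots> = b \<cdot>\<^bsub>T\<^esub> (\<phi> L \<cdot>\<^bsub>T\<^esub> amap jl (\<kappa>jl M))"
    using jl_j.counit.naturality'[of b] b(1-3) M L by (simp add: L_def)
  also have "\<dots> = b" using jl_j.triangle_left[OF M] b(1-3) by (simp add: L_def)
  finally have \<phi>p: "\<phi> X \<cdot>\<^bsub>T\<^esub> amap jl p = b" .
  have "q \<cdot>\<^bsub>T'\<^esub> f = amap ir u \<cdot>\<^bsub>T'\<^esub> (\<kappa>i N \<cdot>\<^bsub>T'\<^esub> f)" using u f N by (simp add: q_def)
  also have "\<dots> = amap ir (u \<cdot>\<^bsub>T\<^esub> amap i f) \<cdot>\<^bsub>T'\<^esub> \<kappa>i (omap ir L)"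
    using i_ir.unit.naturality'[of f] u f(1,3) f' L by simp
  also have "\<dots> = amap ir b \<cdot>\<^bsub>T'\<^esub> (amap ir (\<epsilon> L) \<cdot>\<^bsub>T'\<^esub> \<kappa>i (omap ir L))"
    unfolding b(4)[symmetric] using b(1-3) \<epsilon> L by simp
  also have "\<dots> = amap ir (\<phi> X \<cdot>\<^bsub>T\<^esub> amap jl p)"
    using i_ir.triangle_right[OF L] b(1-3) \<phi>p by simp
  also have "\<dots> = amap ir (\<phi> X) \<cdot>\<^bsub>T'\<^esub> amap ir (amap jl p)" using p X by simp
  finally show ?thesis
    using that[of X p q] X p q p_iso q_iso by (simp add: i.dom.in_Hom j.cod.in_Hom)
qed

text \<open>An arrow killed by \<open>j\<close> factors through some \<open>i Z\<close>, and \<open>ir g = 0\<close> kills every composite of \<open>g\<close>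
  with an arrow from \<open>i Z\<close>.\<close>

lemma comp_zero:
  assumes f: "f \<in> arr T" "amap j f = zero T'' (omap j (src T f)) (omap j (tgt T f))"
    and g: "g \<in> arr T" "amap ir g = zero T' (omap ir (src T g)) (omap ir (tgt T g))"
    and fg: "src T g = tgt T f"
  shows "g \<cdot>\<^bsub>T\<^esub> f = zero T (src T f) (tgt T g)"
proof -
  define X Y Z where "X = src T f" and "Y = tgt T f" and "Z = tgt T g"
  have f': "f \<in> arr T" "src T f = X" "tgt T f = Y" and g': "g \<in> arr T" "src T g = Y" "tgt T g = Z"
    using f g fg by (simp_all add: X_def Y_def Z_def)
  have obs: "X \<in> obj T" "Y \<in> obj T" "Z \<in> obj T" using f g by (simp_all add: X_def Y_def Z_def)
  obtain \<sigma> where \<sigma>: "(\<phi> X, \<psi> X, \<sigma>) \<in> exact T" using triangle_jl_j[OF obs(1)] by blast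
  \<comment> \<open>The obstruction to factoring \<open>f\<close> through \<open>\<psi> X\<close> is
    transported by naturality of \<phi> to \<open>jl (j f) = 0\<close>.\<close>
  have "f \<cdot>\<^bsub>T\<^esub> \<phi> X = \<phi> Y \<cdot>\<^bsub>T\<^esub> amap jl (amap j f)"
    using jl_j.counit.naturality'[of f] f' by simp
  also have "\<dots> = zero T (src T (\<phi> X)) (tgt T f)"
    unfolding f(2) using f' obs by simp
  finally have "f \<cdot>\<^bsub>T\<^esub> \<phi> X = zero T (src T (\<phi> X)) (tgt T f)" .
  from i.cod.factor_through_second[OF \<sigma> f(1) _ this]
  obtain r where r: "r \<in> arr T" "src T r = omap i (omap il X)" "tgt T r = Y" "r \<cdot>\<^bsub>T\<^esub> \<psi> X = f"
    using f' obs by auto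
  define N where "N = omap il X"
  have N: "N \<in> obj T'" "src T r = omap i N" using obs r by (simp_all add: N_def)
  \<comment> \<open>Splitting the identity of \<open>i N\<close> through the counit lets naturality
    of \<epsilon> move \<open>g r\<close> inside \<open>ir\<close>, where
    \<open>ir g = 0\<close>.\<close>
  have "g \<cdot>\<^bsub>T\<^esub> r = (g \<cdot>\<^bsub>T\<^esub> r) \<cdot>\<^bsub>T\<^esub> (\<epsilon> (omap i N) \<cdot>\<^bsub>T\<^esub> amap i (\<kappa>i N))"
    using i_ir.triangle_left[OF N(1)] r g' N by simp
  also have "\<dots> = ((g \<cdot>\<^bsub>T\<^esub> r) \<cdot>\<^bsub>T\<^esub> \<epsilon> (omap i N)) \<cdot>\<^bsub>T\<^esub> amap i (\<kappa>i N)"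
    using r(1,3) g' N by simp
  also have "(g \<cdot>\<^bsub>T\<^esub> r) \<cdot>\<^bsub>T\<^esub> \<epsilon> (omap i N) = \<epsilon> Z \<cdot>\<^bsub>T\<^esub> amap i (amap ir g \<cdot>\<^bsub>T'\<^esub> amap ir r)"
    using i_ir.counit.naturality'[of "g \<cdot>\<^bsub>T\<^esub> r"] r(1,3) g' N by simp
  also have "\<dots> = zero T (omap i (omap ir (omap i N))) Z"
    unfolding g(2) using r(1,3) g' N obs by simp
  also have "zero T (omap i (omap ir (omap i N))) Z \<cdot>\<^bsub>T\<^esub> amap i (\<kappa>i N) = zero T (omap i N) Z"
    using N obs by simp
  finally have gr: "g \<cdot>\<^bsub>T\<^esub> r = zero T (omap i N) Z" .
  have "g \<cdot>\<^bsub>T\<^esub> f = (g \<cdot>\<^bsub>T\<^esub> r) \<cdot>\<^bsub>T\<^esub> \<psi> X"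
    unfolding r(4)[symmetric] using r(1-3) g' obs by simp
  also have "\<dots> = zero T X Z" unfolding gr using obs by (simp add: N_def)
  finally show ?thesis by (simp add: X_def Z_def)
qed

end

section \<open>The comparison functor into the comma category\<close>

lemma comma_functor_simps [simp]:
  "omap (comma_functor T j ir \<phi>) X = (omap j X, omap ir X, amap ir (\<phi> X))"
  "amap (comma_functor T j ir \<phi>) f =
    ((omap j (src T f), omap ir (src T f), amap ir (\<phi> (src T f))),
     (omap j (tgt T f), omap ir (tgt T f), amap ir (\<phi> (tgt T f))), (amap j f, amap ir f))"
  by (simp_all add: comma_functor_def Let_def)

theorem theorem3p2:
  fixes T' :: "('o1, 'm1) tri_cat" and T :: "('o, 'm) tri_cat" and T'' :: "('o2, 'm2) tri_cat"
    and i :: "('o1, 'm1, 'o, 'm) tri_functor_data"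
    and il ir :: "('o, 'm, 'o1, 'm1) tri_functor_data"
    and j :: "('o, 'm, 'o2, 'm2) tri_functor_data"
    and jl jr :: "('o2, 'm2, 'o, 'm) tri_functor_data"
  assumes "recollement T' T T'' i il ir j jl jr \<psi> \<kappa>il \<kappa>i \<epsilon> \<kappa>jl \<phi> \<eta> \<kappa>j"
  shows "let \<C> = comma T'' T' (ir \<circ>\<^sub>F jl); \<Phi> = comma_functor T j ir \<phi> in
    additive_functor T \<C> \<Phi> \<and> full T \<C> \<Phi> \<and> dense T \<C> \<Phi> \<and>
    square_zero T (kernel_ideal T \<C> \<Phi>) \<and> epivalence T \<C> \<Phi>"
proof -
  interpret recollement T' T T'' i il ir j jl jr \<psi> \<kappa>il \<kappa>i \<epsilon> \<kappa>jl \<phi> \<eta> \<kappa>j by fact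
  interpret irjl: additive_functor T'' T' "ir \<circ>\<^sub>F jl"
    by (rule additive_functor_comp[OF jl.additive_functor_axioms ir.additive_functor_axioms])
  define \<C> where "\<C> = comma T'' T' (ir \<circ>\<^sub>F jl)"
  define \<Phi> where "\<Phi> = comma_functor T j ir \<phi>"
  interpret \<C>: preadditive_category \<C>
    unfolding \<C>_def by (rule irjl.preadditive_comma)
  note \<C>_simps = comma_simps[of T'' T' "ir \<circ>\<^sub>F jl", folded \<C>_def]
  note \<Phi>_simps = comma_functor_simps[of T j ir \<phi>, folded \<Phi>_def]
  have obj: "omap \<Phi> X \<in> obj \<C>" if "X \<in> obj T" for X
    using that by (simp add: \<C>_def \<Phi>_simps comma_obj_iff i.dom.in_Hom)
  have arr: "amap \<Phi> f \<in> Hom \<C> (omap \<Phi> X) (omap \<Phi> Y)" if f: "f \<in> Hom T X Y" for f X Y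
  proof -
    have f': "f \<in> arr T" "src T f = X" "tgt T f = Y" "X \<in> obj T" "Y \<in> obj T"
      using f i.cod.Hom_obj[OF f] by (simp_all add: i.cod.in_Hom)
    \<comment> \<open>The square required of the image of \<open>f\<close> is \<open>ir\<close>
      applied to naturality of \<phi>.\<close>
    have "amap ir (\<phi> Y \<cdot>\<^bsub>T\<^esub> amap jl (amap j f)) = amap ir (f \<cdot>\<^bsub>T\<^esub> \<phi> X)"
      using jl_j.counit.naturality'[of f] f' by simp
    then show ?thesis
      using f' obj[of X] obj[of Y] unfolding \<Phi>_simps \<C>_def
      by (auto intro!: comma_HomI simp: i.dom.in_Hom j.cod.in_Hom)
  qed
  have is_functor: "is_functor T \<C> \<Phi>"
  proof (intro is_functor.intro is_functor_axioms.intro i.cod.category_axioms \<C>.category_axioms)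
    fix f g X Y Z
    assume "f \<in> Hom T X Y" "g \<in> Hom T Y Z"
    then show "amap \<Phi> (g \<cdot>\<^bsub>T\<^esub> f) = amap \<Phi> g \<cdot>\<^bsub>\<C>\<^esub> amap \<Phi> f"
      by (simp add: \<Phi>_simps \<C>_simps i.cod.in_Hom)
  qed (use obj arr in \<open>simp_all add: \<Phi>_simps \<C>_simps\<close>)
  have additive: "additive_functor T \<C> \<Phi>"
  proof (intro additive_functor.intro additive_functor_axioms.intro is_functor
      i.cod.preadditive_category_axioms \<C>.preadditive_category_axioms homI)
    fix X Y f assume "f \<in> carrier (hom_group T X Y)"
    then have f: "f \<in> Hom T X Y" by (simp add: hom_group_def)
    then show "amap \<Phi> f \<in> carrier (hom_group \<C> (omap \<Phi> X) (omap \<Phi> Y))"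
      using arr by (simp add: hom_group_def)
    fix g assume "g \<in> carrier (hom_group T X Y)"
    then have g: "g \<in> Hom T X Y" by (simp add: hom_group_def)
    show "amap \<Phi> (f \<otimes>\<^bsub>hom_group T X Y\<^esub> g) =
        amap \<Phi> f \<otimes>\<^bsub>hom_group \<C> (omap \<Phi> X) (omap \<Phi> Y)\<^esub> amap \<Phi> g"
      using f g
      by (simp add: hom_group_def \<Phi>_simps \<C>_simps i.cod.in_Hom j.amap_add ir.amap_add)
  qed
  have full: "full T \<C> \<Phi>"
    unfolding full_def
  proof (intro ballI)
    fix X Y g assume X: "X \<in> obj T" and Y: "Y \<in> obj T" and g: "g \<in> Hom \<C> (omap \<Phi> X) (omap \<Phi> Y)"
    obtain a b where ab: "g = (omap \<Phi> X, omap \<Phi> Y, (a, b))"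
      "a \<in> Hom T'' (omap j X) (omap j Y)" "b \<in> Hom T' (omap ir X) (omap ir Y)"
      "amap ir (\<phi> Y) \<cdot>\<^bsub>T'\<^esub> amap ir (amap jl a) = b \<cdot>\<^bsub>T'\<^esub> amap ir (\<phi> X)"
      using g unfolding \<C>_def by (rule comma_HomE) (auto simp: \<Phi>_simps)
    then obtain f where "f \<in> Hom T X Y" "amap j f = a" "amap ir f = b"
      using lift_arrow[OF X Y, of a b] by (auto simp: i.dom.in_Hom j.cod.in_Hom)
    then show "\<exists>f\<in>Hom T X Y. amap \<Phi> f = g"
      by (intro bexI[of _ f]) (simp_all add: ab(1) \<Phi>_simps i.cod.in_Hom)
  qed
  have dense: "dense T \<C> \<Phi>"
    unfolding dense_def
  proof
    fix Q assume Q: "Q \<in> obj \<C>"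
    obtain M N f where Q_eq: "Q = (M, N, f)" by (cases Q)
    have MN: "M \<in> obj T''" "N \<in> obj T'" "f \<in> arr T'" "src T' f = omap ir (omap jl M)" "tgt T' f = N"
      using Q by (simp_all add: Q_eq \<C>_def comma_obj_iff i.dom.in_Hom)
    obtain X a b where X: "X \<in> obj T" "a \<in> Hom T'' M (omap j X)" "b \<in> Hom T' N (omap ir X)"
      "is_iso T'' a" "is_iso T' b" "amap ir (\<phi> X) \<cdot>\<^bsub>T'\<^esub> amap ir (amap jl a) = b \<cdot>\<^bsub>T'\<^esub> f"
      by (rule realize_object[OF MN])
    have "isomorphic \<C> (omap \<Phi> X) Q"
      unfolding \<C>_def Q_eq \<Phi>_simps
      by (rule irjl.comma_isomorphicI[OF comma_HomI X(4,5)])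
        (use X Q obj[OF X(1)] in \<open>simp_all add: Q_eq \<C>_def \<Phi>_simps\<close>)
    with X(1) show "\<exists>X\<in>obj T. isomorphic \<C> (omap \<Phi> X) Q" by blast
  qed
  have square_zero: "square_zero T (kernel_ideal T \<C> \<Phi>)"
    unfolding square_zero_def kernel_ideal_def
    \<comment> \<open>A zero arrow of the comma category is zero in both components;
      \<open>comp_zero\<close> takes the \<open>j\<close> component of the first arrow and the
      \<open>ir\<close> component of the second.\<close>
    by (auto simp: \<Phi>_simps \<C>_simps intro!: comp_zero)
  have "epivalence T \<C> \<Phi>"
    using is_functor full dense additive_functor.detects_isos_if_square_zero[OF additive full square_zero]
    by (simp add: epivalence_def)
  with additive full dense square_zero show ?thesis
    by (simp add: Let_def \<C>_def \<Phi>_def)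
qed

end
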